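(* Let $\mathscr{C}$ be a class of finite graphs. If the class of all paths is not $\mathrm{FO}$-transducible from $\mathscr{C}$, then $\mathscr{C}$ has bounded shrubdepth.
   Context: Graphs are finite and simple. A coloring of a graph $G$ is the structure obtained from $G$ by adding an arbitrary interpretation of countably many unary predicates $P_1,P_2,\dots$ (arbitrary vertex subsets, not necessarily disjoint). A (non-copying) $\mathrm{FO}$-transduction $\mathsf T$ is given by two first-order formulas $\rho_0(x)$ and $\rho_E(x,y)$ in the signature consisting of the binary edge relation $E$ and the unary predicates $P_i$; for a colored graph $\Lambda(G)$, the output graph has vertex set $\{v:\Lambda(G)\models\rho_0(v)\}$ and two distinct output vertices $u,v$ adjacent iff $\Lambda(G)\models \rho_E(u,v)\vee\rho_E(v,u)$. Then $\mathsf T(G)$ is the set of all outputs over all colorings $\Lambda$ of $G$, and $\mathsf T(\mathscr{C})=\bigcup_{G\in\mathscr{C}}\mathsf T(G)$. A class $\mathscr{D}$ is $\mathrm{FO}$-transducible from $\mathscr{C}$ if there is an $\mathrm{FO}$-transduction $\mathsf T$ with $\mathscr{D}\subseteq\mathsf T(\mathscr{C})$. A $k$-colored height-$h$ tree model is a triple $(T,c,f)$ where $T$ is a rooted tree of height at most $h$ (height = maximum number of edges on a root-to-leaf path), $c$ maps the leaves of $T$ to $[k]$, and $f:I(T)\times[k]\times[k]\to\{0,1\}$ ($I(T)$ the internal vertices) is symmetric in its last two arguments. It defines the graph with vertex set the leaves of $T$, where distinct leaves $u,v$ are adjacent iff $f(u\wedge v, c(u),c(v))=1$, $u\wedge v$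 being their lowest common ancestor. A class $\mathscr{C}$ has bounded shrubdepth if there exist integers $k,h$ such that every graph in $\mathscr{C}$ is (isomorphic to a graph) defined by a $k$-colored height-$h$ tree model. *)

theory Defs
  imports
    "Graph_Theory.Pair_Digraph"
    "Graph_Theory.Digraph_Isomorphism"
begin

text \<open>
  A finite simple graph is a \<open>pair_graph\<close>: finitely many vertices and a symmetric, loop-free
  arc relation. A class of graphs is represented by a set of graphs over some vertex type,
  read up to isomorphism; over an infinite vertex type, every class of finite
  graphs is represented in this way.
\<close>

abbreviation graph_iso :: "'a pair_pre_digraph \<Rightarrow> 'b pair_pre_digraph \<Rightarrow> bool" where
  "graph_iso G H \<equiv> digraph_iso (with_proj G) (with_proj H)"

definition path_graph :: "nat \<Rightarrow> nat pair_pre_digraph" where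
  "path_graph n = \<lparr> pverts = {..<n},
     parcs = {(i, j). i < n \<and> j < n \<and> (j = Suc i \<or> i = Suc j)} \<rparr>"

definition all_paths :: "nat pair_pre_digraph set" where
  "all_paths = {path_graph n | n. n \<ge> 1}"


section \<open>First-order logic on colored graphs and transductions\<close>

text \<open>Variables and the unary predicates are indexed by natural numbers.\<close>

datatype fo =
    Eq nat nat
  | Edge nat nat
  | Pred nat nat
  | Neg fo
  | Conj fo fo
  | Ex nat fo

fun free_vars :: "fo \<Rightarrow> nat set" where
  "free_vars (Eq x y) = {x, y}"
| "free_vars (Edge x y) = {x, y}"
| "free_vars (Pred i x) = {x}"
| "free_vars (Neg \<phi>) = free_vars \<phi>"
| "free_vars (Conj \<phi> \<psi>) = free_vars \<phi> \<union> free_vars \<psi>"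
| "free_vars (Ex x \<phi>) = free_vars \<phi> - {x}"

fun sat :: "'a pair_pre_digraph \<Rightarrow> (nat \<Rightarrow> 'a set) \<Rightarrow> (nat \<Rightarrow> 'a) \<Rightarrow> fo \<Rightarrow> bool" where
  "sat G P s (Eq x y) \<longleftrightarrow> s x = s y"
| "sat G P s (Edge x y) \<longleftrightarrow> (s x, s y) \<in> parcs G"
| "sat G P s (Pred i x) \<longleftrightarrow> s x \<in> P i"
| "sat G P s (Neg \<phi>) \<longleftrightarrow> \<not> sat G P s \<phi>"
| "sat G P s (Conj \<phi> \<psi>) \<longleftrightarrow> sat G P s \<phi> \<and> sat G P s \<psi>"
| "sat G P s (Ex x \<phi>) \<longleftrightarrow> (\<exists>v\<in>pverts G. sat G P (s(x := v)) \<phi>)"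

definition coloring :: "'a pair_pre_digraph \<Rightarrow> (nat \<Rightarrow> 'a set) \<Rightarrow> bool" where
  "coloring G P \<longleftrightarrow> (\<forall>i. P i \<subseteq> pverts G)"

text \<open>
  The vertex formula has only variable 0 free, the edge formula only variables 0 and 1.
\<close>

record transduction =
  vert_fm :: fo
  edge_fm :: fo

definition fo_transduction :: "transduction \<Rightarrow> bool" where
  "fo_transduction T \<longleftrightarrow> free_vars (vert_fm T) \<subseteq> {0} \<and> free_vars (edge_fm T) \<subseteq> {0, 1}"

definition holds_vert :: "transduction \<Rightarrow> 'a pair_pre_digraph \<Rightarrow> (nat \<Rightarrow> 'a set) \<Rightarrow> 'a \<Rightarrow> bool" where
  "holds_vert T G P v \<longleftrightarrow> sat G P (\<lambda>_. v) (vert_fm T)"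

definition holds_edge ::
    "transduction \<Rightarrow> 'a pair_pre_digraph \<Rightarrow> (nat \<Rightarrow> 'a set) \<Rightarrow> 'a \<Rightarrow> 'a \<Rightarrow> bool" where
  "holds_edge T G P u v \<longleftrightarrow> sat G P ((\<lambda>_. v)(0 := u)) (edge_fm T)"

definition transduction_output ::
    "transduction \<Rightarrow> 'a pair_pre_digraph \<Rightarrow> (nat \<Rightarrow> 'a set) \<Rightarrow> 'a pair_pre_digraph" where
  "transduction_output T G P =
     (let W = {v \<in> pverts G. holds_vert T G P v} in
      \<lparr> pverts = W,
        parcs = {(u, v). u \<in> W \<and> v \<in> W \<and> u \<noteq> v \<and>
                         (holds_edge T G P u v \<or> holds_edge T G P v u)} \<rparr>)"

definition transduce :: "transduction \<Rightarrow> 'a pair_pre_digraph \<Rightarrow> 'a pair_pre_digraph set" where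
  "transduce T G = {transduction_output T G P | P. coloring G P}"

definition transduce_class ::
    "transduction \<Rightarrow> 'a pair_pre_digraph set \<Rightarrow> 'a pair_pre_digraph set" where
  "transduce_class T C = (\<Union>G\<in>C. transduce T G)"

text \<open>The inclusion of \<open>D\<close> in \<open>transduce_class T C\<close> is taken up to isomorphism.\<close>

definition fo_transducible_from ::
    "'b pair_pre_digraph set \<Rightarrow> 'a pair_pre_digraph set \<Rightarrow> bool" where
  "fo_transducible_from D C \<longleftrightarrow>
     (\<exists>T. fo_transduction T \<and> (\<forall>H\<in>D. \<exists>H'\<in>transduce_class T C. graph_iso H H'))"


section \<open>Tree models and shrubdepth\<close>

text \<open>
  Rooted trees are represented with their arcs directed away from the root. (The predicate
  \<open>tree\<close> of the graph library is not suitable: it forbids only directed cycles,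
  so it admits directed acyclic graphs that are not trees.)
\<close>

definition rooted_tree :: "'n pair_pre_digraph \<Rightarrow> 'n \<Rightarrow> bool" where
  "rooted_tree T r \<longleftrightarrow> pair_fin_digraph T \<and> r \<in> pverts T \<and>
     (\<forall>v\<in>pverts T. \<exists>!p. pre_digraph.awalk (with_proj T) r p v)"

definition height_at_most :: "'n pair_pre_digraph \<Rightarrow> 'n \<Rightarrow> nat \<Rightarrow> bool" where
  "height_at_most T r h \<longleftrightarrow>
     (\<forall>v p. pre_digraph.awalk (with_proj T) r p v \<longrightarrow> length p \<le> h)"

definition leaves :: "'n pair_pre_digraph \<Rightarrow> 'n set" where
  "leaves T = {v \<in> pverts T. \<forall>w. (v, w) \<notin> parcs T}"

definition internal :: "'n pair_pre_digraph \<Rightarrow> 'n set" where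
  "internal T = pverts T - leaves T"

abbreviation ancestor :: "'n pair_pre_digraph \<Rightarrow> 'n \<Rightarrow> 'n \<Rightarrow> bool" where
  "ancestor T u v \<equiv> reachable (with_proj T) u v"

definition lca :: "'n pair_pre_digraph \<Rightarrow> 'n \<Rightarrow> 'n \<Rightarrow> 'n" where
  "lca T u v = (THE w. ancestor T w u \<and> ancestor T w v \<and>
     (\<forall>x. ancestor T x u \<and> ancestor T x v \<longrightarrow> ancestor T x w))"

definition tree_model ::
    "nat \<Rightarrow> nat \<Rightarrow> 'n pair_pre_digraph \<Rightarrow> 'n \<Rightarrow> ('n \<Rightarrow> nat) \<Rightarrow> ('n \<Rightarrow> nat \<Rightarrow> nat \<Rightarrow> bool) \<Rightarrow> bool"
  where
  "tree_model k h T r c f \<longleftrightarrow> rooted_tree T r \<and> height_at_most T r h \<and>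
     (\<forall>v\<in>leaves T. c v \<in> {1..k}) \<and>
     (\<forall>x\<in>internal T. \<forall>i\<in>{1..k}. \<forall>j\<in>{1..k}. f x i j = f x j i)"

definition model_graph ::
    "'n pair_pre_digraph \<Rightarrow> ('n \<Rightarrow> nat) \<Rightarrow> ('n \<Rightarrow> nat \<Rightarrow> nat \<Rightarrow> bool) \<Rightarrow> 'n pair_pre_digraph" where
  "model_graph T c f = \<lparr> pverts = leaves T,
     parcs = {(u, v). u \<in> leaves T \<and> v \<in> leaves T \<and> u \<noteq> v \<and> f (lca T u v) (c u) (c v)} \<rparr>"

text \<open>
  A rooted tree has at least one leaf, so no tree model defines the graph without vertices.
  That graph is exempted, as if defined by an empty tree; otherwise it alone
  would make a class unbounded. Since trees are finite, it is enough to consider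
  trees with natural numbers as nodes.
\<close>

definition bounded_shrubdepth :: "'a pair_pre_digraph set \<Rightarrow> bool" where
  "bounded_shrubdepth C \<longleftrightarrow>
     (\<exists>k h. \<forall>G\<in>C. pverts G \<noteq> {} \<longrightarrow>
        (\<exists>(T :: nat pair_pre_digraph) r c f. tree_model k h T r c f \<and> graph_iso G (model_graph T c f)))"

end

theory Submission
  imports Defs "HOL-Library.Countable"
begin

text \<open>
  View \<open>G\<close> as a bipartite graph between two copies of its vertex set. If no paths can be
  transduced, then this graph contains no long half graph, and neither it nor its bipartite
  complement contains a long induced path.

  The absence of half graphs bounds a tree rank (Hodges), and by induction on this rank every vertex
  may be assumed to have either a simple neighbourhood or a simple non-neighbourhood. If all
  neighbourhoods are simple, a complicated graph contains a long induced path, as in Gyarfas'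
  argument for \<open>\<chi>\<close>-boundedness; the mixed case gives a half graph. Hence both copies split into boundedly many
  parts such that any two parts span a graph that is dismantled by boundedly many rounds of passing
  to connected components, alternately of the graph and of its bipartite complement.

  As induced paths are short, connectedness in each round is first-order definable. Thus \<open>G\<close> is encoded by
  boundedly many definable equivalence relations. A long path in the incidence graph of
  vertices and equivalence classes, with all its vertices and classes distinct, would again transduce
  a path. In its absence, the incidence graph has a bounded-depth elimination in which each step deletes all
  classes of one vertex, and this yields the tree model.
\<close>

section \<open>Connected components\<close>

text \<open>The coloring into pieces does not have to be definable: it is only shown to exist, with
  boundedly many colors, and is handed to the formulas as unary predicates. What the formulas must
  define is connectedness inside a piece. A shortest connection is an induced path, hence of bounded
  length; this persists in deeper rounds because a chord between two vertices of one component is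
  again a step of that round. Adjacency of two vertices is read off from the parity of the last
  round in which their copies are still together.

  The constants are fixed in the order \<open>N\<close>, \<open>m\<close>, \<open>n\<close>:
  \<open>N\<close> bounds the forbidden patterns, \<open>m\<close> is computed from \<open>N\<close>
  and bounds both colors and rounds, and \<open>n\<close> bounds the incidence paths, whose formula
  mentions \<open>N\<close> and \<open>m\<close>. An incidence path need not be induced: predicates
  mark the slots through which each of its vertices is left and entered, and distinctness of the
  classes rules out shortcuts.\<close>

definition component :: "('a \<Rightarrow> 'a \<Rightarrow> bool) \<Rightarrow> 'a set \<Rightarrow> 'a \<Rightarrow> 'a set" where
  "component Q Z x = {y\<in>Z. (\<lambda>u v. u \<in> Z \<and> v \<in> Z \<and> Q u v)\<^sup>*\<^sup>* x y}"

lemma component_subset: "component Q Z x \<subseteq> Z"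
  by (auto simp: component_def)

lemma component_refl: "x \<in> Z \<Longrightarrow> x \<in> component Q Z x"
  by (auto simp: component_def)

lemma component_step: "y \<in> component Q Z x \<Longrightarrow> Q y z \<Longrightarrow> z \<in> Z \<Longrightarrow> z \<in> component Q Z x"
  by (auto simp: component_def intro: rtranclp.rtrancl_into_rtrancl)

lemma component_mono: "Y \<subseteq> Z \<Longrightarrow> component Q Y x \<subseteq> component Q Z x"
  unfolding component_def by (auto elim!: rtranclp_mono[THEN predicate2D, rotated])

lemma component_induct [consumes 1, case_names base step]:
  assumes "y \<in> component Q Z x" "x \<in> Z \<Longrightarrow> P x"
    "\<And>u w. u \<in> component Q Z x \<Longrightarrow> w \<in> Z \<Longrightarrow> Q u w \<Longrightarrow> P u \<Longrightarrow> P w"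
  shows "P y"
proof -
  have "(\<lambda>u v. u \<in> Z \<and> v \<in> Z \<and> Q u v)\<^sup>*\<^sup>* x y" "y \<in> Z" using assms(1) by (auto simp: component_def)
  then show ?thesis
  proof induction
    case (step u w)
    then have "u \<in> component Q Z x" by (simp add: component_def)
    then show ?case using assms(3) step by blast
  qed (use assms(2) in blast)
qed

lemma component_eq:
  assumes "symp Q" "y \<in> component Q Z x" shows "component Q Z y = component Q Z x"
proof -
  let ?R = "\<lambda>u v. u \<in> Z \<and> v \<in> Z \<and> Q u v"
  have "symp ?R" using assms(1) by (auto simp: symp_def)
  then have "symp ?R\<^sup>*\<^sup>*" by (rule symp_rtranclp)
  then have "?R\<^sup>*\<^sup>* x y" "?R\<^sup>*\<^sup>* y x" using assms by (auto simp: component_def symp_def)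
  then show ?thesis by (auto simp: component_def intro: rtranclp_trans)
qed

lemma component_component:
  assumes "symp Q" "y \<in> component Q Z x"
  shows "component Q (component Q Z x) y = component Q Z x"
proof
  have "component Q Z y \<subseteq> component Q (component Q Z x) y"
  proof
    fix z assume "z \<in> component Q Z y"
    then show "z \<in> component Q (component Q Z x) y"
    proof (induction rule: component_induct)
      case base
      show ?case using assms(2) by (simp add: component_refl)
    next
      case (step u w)
      then have "w \<in> component Q Z y" by (blast intro: component_step)
      then show ?case using component_step[of _ Q _ y, OF step.IH step(3)] component_eq[OF assms] by simp
    qed
  qed
  then show "component Q Z x \<subseteq> component Q (component Q Z x) y"
    by (simp only: component_eq[OF assms])
qed (rule component_subset)

section \<open>Tree rank and half graphs\<close>

text \<open>This is the Littlestone dimension (Shelah's 2-rank): a full binary decision tree with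
  tests from \<open>Y\<close>, every branch of which is realized by an element of
  \<open>Z\<close>.\<close>

fun tree_rank_ge :: "('y \<Rightarrow> 'z \<Rightarrow> bool) \<Rightarrow> nat \<Rightarrow> 'y set \<Rightarrow> 'z set \<Rightarrow> bool" where
  "tree_rank_ge R 0 Y Z \<longleftrightarrow> Z \<noteq> {}"
| "tree_rank_ge R (Suc n) Y Z \<longleftrightarrow>
     (\<exists>y\<in>Y. tree_rank_ge R n Y {z\<in>Z. R y z} \<and> tree_rank_ge R n Y {z\<in>Z. \<not> R y z})"

lemma tree_rank_ge_mono:
  "tree_rank_ge R n Y Z \<Longrightarrow> Y \<subseteq> Y' \<Longrightarrow> Z \<subseteq> Z' \<Longrightarrow> tree_rank_ge R n Y' Z'"
proof (induction n arbitrary: Z Z')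
  case (Suc n)
  then obtain y where y: "y \<in> Y" "tree_rank_ge R n Y {z\<in>Z. R y z}" "tree_rank_ge R n Y {z\<in>Z. \<not> R y z}"
    by auto
  have "tree_rank_ge R n Y' {z\<in>Z'. R y z}" "tree_rank_ge R n Y' {z\<in>Z'. \<not> R y z}"
    by (rule Suc.IH[OF y(2)], use Suc.prems in auto)
      (rule Suc.IH[OF y(3)], use Suc.prems in auto)
  then show ?case using y(1) Suc.prems by auto
qed auto

lemma tree_rank_ge_nonempty: "tree_rank_ge R n Y Z \<Longrightarrow> Z \<noteq> {}"
  by (induction n arbitrary: Z) auto

lemma tree_rank_ge_le: "tree_rank_ge R n Y Z \<Longrightarrow> m \<le> n \<Longrightarrow> tree_rank_ge R m Y Z"
proof (induction n arbitrary: m Z)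
  case (Suc n)
  show ?case
  proof (cases m)
    case 0
    then show ?thesis using tree_rank_ge_nonempty[OF Suc.prems(1)] by simp
  next
    case (Suc m')
    then show ?thesis using Suc.IH[of _ m'] Suc.prems by auto
  qed
qed auto

text \<open>Ramsey property of full binary trees whose inner nodes are 2-colored. If the root has
  color \<open>Y1\<close>, either both subtrees contain a \<open>Y1\<close>-tree of depth
  \<open>n - 1\<close>, which the root joins, or one of them already contains the
  \<open>Y2\<close>-tree of depth \<open>m\<close>.\<close>

lemma tree_rank_ge_split:
  "tree_rank_ge R (n + m) (Y1 \<union> Y2) Z \<Longrightarrow> tree_rank_ge R n Y1 Z \<or> tree_rank_ge R m Y2 Z"
proof (induction "n + m" arbitrary: n m Z)
  case 0
  then show ?case by auto
next
  case (Suc k)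
  note ne = tree_rank_ge_nonempty[OF Suc.prems]
  show ?case
  proof (cases "n = 0 \<or> m = 0")
    case True
    then show ?thesis using ne by auto
  next
    case False
    then obtain n' m' where nm: "n = Suc n'" "m = Suc m'" by (meson not0_implies_Suc)
    from Suc.prems Suc.hyps(2)[symmetric] obtain y where y: "y \<in> Y1 \<union> Y2"
      "tree_rank_ge R k (Y1 \<union> Y2) {z\<in>Z. R y z}" "tree_rank_ge R k (Y1 \<union> Y2) {z\<in>Z. \<not> R y z}"
      by auto
    have k: "k = n' + m" "k = n + m'" using Suc.hyps(2) nm by auto
    show ?thesis
    proof (cases "y \<in> Y1")
      case True
      have "tree_rank_ge R n' Y1 {z\<in>Z. R y z} \<or> tree_rank_ge R m Y2 {z\<in>Z. R y z}"
        using Suc.hyps(1)[OF k(1)] y(2) k(1) by simp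
      moreover have "tree_rank_ge R n' Y1 {z\<in>Z. \<not> R y z} \<or> tree_rank_ge R m Y2 {z\<in>Z. \<not> R y z}"
        using Suc.hyps(1)[OF k(1)] y(3) k(1) by simp
      ultimately show ?thesis using True nm(1)
        by (auto dest: tree_rank_ge_mono[where Y' = Y2 and Z' = Z])
    next
      case False
      then have "y \<in> Y2" using y by auto
      have "tree_rank_ge R n Y1 {z\<in>Z. R y z} \<or> tree_rank_ge R m' Y2 {z\<in>Z. R y z}"
        using Suc.hyps(1)[OF k(2)] y(2) k(2) by simp
      moreover have "tree_rank_ge R n Y1 {z\<in>Z. \<not> R y z} \<or> tree_rank_ge R m' Y2 {z\<in>Z. \<not> R y z}"
        using Suc.hyps(1)[OF k(2)] y(3) k(2) by simp
      ultimately show ?thesis using \<open>y \<in> Y2\<close> nm(2)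
        by (auto dest: tree_rank_ge_mono[where Y' = Y1 and Z' = Z])
    qed
  qed
qed

definition half_graph :: "('y \<Rightarrow> 'z \<Rightarrow> bool) \<Rightarrow> nat \<Rightarrow> 'y set \<Rightarrow> 'z set \<Rightarrow> bool" where
  "half_graph R k Y Z \<longleftrightarrow> (\<exists>a b. (\<forall>i<k. a i \<in> Y \<and> b i \<in> Z) \<and>
     (\<forall>i<k. \<forall>j<k. R (a i) (b j) \<longleftrightarrow> j \<le> i))"

lemma half_graph_0: "half_graph R 0 Y Z"
  by (simp add: half_graph_def)

lemma half_graph_mono: "half_graph R k Y Z \<Longrightarrow> Y \<subseteq> Y' \<Longrightarrow> Z \<subseteq> Z' \<Longrightarrow> half_graph R k Y' Z'"
  unfolding half_graph_def by blast

lemma half_graph_le: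
  assumes "half_graph R k Y Z" "l \<le> k" shows "half_graph R l Y Z"
proof -
  from assms(1) obtain a b where "\<forall>i<k. a i \<in> Y \<and> b i \<in> Z" "\<forall>i<k. \<forall>j<k. R (a i) (b j) \<longleftrightarrow> j \<le> i"
    unfolding half_graph_def by (elim exE conjE) (rule that)
  then show ?thesis
    unfolding half_graph_def using assms(2) by (intro exI[of _ a] exI[of _ b]) simp
qed

text \<open>The pair \<open>y\<close>, \<open>z\<close> is prepended at index 0: \<open>z\<close> is
  related to every remaining row and \<open>y\<close> to no remaining column, as the pattern
  \<open>j \<le> i\<close> demands.\<close>

lemma half_graph_Suc:
  assumes "half_graph R k {y\<in>Y. R y z} {x\<in>Z. \<not> R y x}" "y \<in> Y" "z \<in> Z" "R y z"
  shows "half_graph R (Suc k) Y Z"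
proof -
  obtain a b where ab: "\<forall>i<k. a i \<in> Y \<and> R (a i) z \<and> b i \<in> Z \<and> \<not> R y (b i)"
    "\<forall>i<k. \<forall>j<k. R (a i) (b j) \<longleftrightarrow> j \<le> i"
    using assms(1) by (auto simp: half_graph_def)
  let ?a = "case_nat y a" and ?b = "case_nat z b"
  have "\<forall>i<Suc k. ?a i \<in> Y \<and> ?b i \<in> Z" "\<forall>i<Suc k. \<forall>j<Suc k. R (?a i) (?b j) \<longleftrightarrow> j \<le> i"
    using ab assms(2-) by (auto split: nat.split)
  then show ?thesis unfolding half_graph_def by blast
qed

text \<open>\<open>k\<close> and \<open>l\<close> are the sizes still to be reached in
  \<open>R\<close> and in its negation; each recursive call lowers one of them. \<open>Suc\<close>
  pays for the consumed root of the tree, the doubling for the Ramsey split.\<close>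

fun hodges_bound :: "nat \<Rightarrow> nat \<Rightarrow> nat" where
  "hodges_bound 0 l = 0"
| "hodges_bound (Suc k) 0 = 0"
| "hodges_bound (Suc k) (Suc l) =
     (let N = Suc (max (hodges_bound k (Suc l)) (hodges_bound (Suc k) l)) in N + N)"

text \<open>A column \<open>z\<close> is fixed before the tree is descended. Splitting the tests by
  their relation to \<open>z\<close> leaves a deep tree on one part, and its root \<open>y\<close>
  forms the next pair with \<open>z\<close>. The recursion enters the subtree where \<open>y\<close>
  has the opposite relation, so that the surviving rows and columns fit
  \<open>half_graph_Suc\<close>.\<close>

lemma half_graph_if_tree_rank_ge:
  "tree_rank_ge R (hodges_bound k l) Y Z \<Longrightarrow>
    half_graph R k Y Z \<or> half_graph (\<lambda>x y. \<not> R x y) l Y Z"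
proof (induction k l arbitrary: Y Z rule: hodges_bound.induct)
  case (3 k l)
  define N where "N = max (hodges_bound k (Suc l)) (hodges_bound (Suc k) l)"
  have r: "tree_rank_ge R (Suc N + Suc N) Y Z" using "3.prems" by (simp add: N_def Let_def)
  then obtain z where z: "z \<in> Z" using tree_rank_ge_nonempty by blast
  have "{y\<in>Y. R y z} \<union> {y\<in>Y. \<not> R y z} = Y" by auto
  then consider "tree_rank_ge R (Suc N) {y\<in>Y. R y z} Z" | "tree_rank_ge R (Suc N) {y\<in>Y. \<not> R y z} Z"
    using tree_rank_ge_split[of R "Suc N" "Suc N" "{y\<in>Y. R y z}" "{y\<in>Y. \<not> R y z}" Z] r by auto
  then show ?case
  proof cases
    case 1
    then obtain y where y: "y \<in> Y" "R y z" "tree_rank_ge R N {y\<in>Y. R y z} {x\<in>Z. \<not> R y x}" by auto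
    then have "tree_rank_ge R (hodges_bound k (Suc l)) {y\<in>Y. R y z} {x\<in>Z. \<not> R y x}"
      by (auto intro: tree_rank_ge_le simp: N_def)
    from "3.IH"(1)[OF this] show ?thesis
    proof
      assume "half_graph R k {y\<in>Y. R y z} {x\<in>Z. \<not> R y x}"
      from half_graph_Suc[OF this y(1) z y(2)] show ?thesis ..
    next
      assume "half_graph (\<lambda>x y. \<not> R x y) (Suc l) {y\<in>Y. R y z} {x\<in>Z. \<not> R y x}"
      from half_graph_mono[OF this] show ?thesis by blast
    qed
  next
    case 2
    then obtain y where y: "y \<in> Y" "\<not> R y z" "tree_rank_ge R N {y\<in>Y. \<not> R y z} {x\<in>Z. R y x}" by auto
    then have "tree_rank_ge R (hodges_bound (Suc k) l) {y\<in>Y. \<not> R y z} {x\<in>Z. R y x}"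
      by (auto intro: tree_rank_ge_le simp: N_def)
    from "3.IH"(2)[OF this] show ?thesis
    proof
      assume "half_graph R (Suc k) {y\<in>Y. \<not> R y z} {x\<in>Z. R y x}"
      from half_graph_mono[OF this] show ?thesis by blast
    next
      assume *: "half_graph (\<lambda>x y. \<not> R x y) l {y\<in>Y. \<not> R y z} {x\<in>Z. R y x}"
      have "half_graph (\<lambda>x y. \<not> R x y) (Suc l) Y Z"
        by (rule half_graph_Suc[where y = y and z = z]) (use * y z in simp_all)
      then show ?thesis ..
    qed
  qed
qed (simp_all add: half_graph_0)

section \<open>Simple bipartite graphs and Gyarfas' path argument\<close>

text \<open>Colors for gluing two \<open>m\<close>-colored sets along a common side: pairs of old
  colors (\<open>m * m\<close>) on that side, a disjoint union (\<open>2 * m\<close>) on the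
  other.\<close>

definition merge_bound :: "nat \<Rightarrow> nat" where "merge_bound m = m * m + 2 * m"

lemma merge_bound_ge: "m \<le> merge_bound m"
  by (simp add: merge_bound_def)

lemma merge_bound_pos: "1 \<le> m \<Longrightarrow> 1 \<le> merge_bound m"
  by (simp add: merge_bound_def)

text \<open>Extending the path by one vertex costs a merge for discarding a neighbourhood and 2 for
  passing to a component.\<close>

fun gyarfas_bound :: "nat \<Rightarrow> nat \<Rightarrow> nat" where
  "gyarfas_bound m 0 = 1"
| "gyarfas_bound m (Suc k) = merge_bound (m + (gyarfas_bound m k + 2))"

lemma gyarfas_bound_ge: "1 \<le> gyarfas_bound m k"
  by (cases k) (auto simp: merge_bound_def)

text \<open>Two merges per step, because a new pair of the half graph restricts the set once for
  each of its two vertices.\<close>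

fun mixed_bound :: "nat \<Rightarrow> nat \<Rightarrow> nat" where
  "mixed_bound m 0 = 1"
| "mixed_bound m (Suc k) = merge_bound (m + merge_bound (m + mixed_bound m k))"

lemma mixed_bound_ge: "1 \<le> mixed_bound m k"
  by (induction k) (auto simp: merge_bound_def)

fun rank_bound :: "nat \<Rightarrow> nat \<Rightarrow> nat" where
  "rank_bound n 0 = 1"
| "rank_bound n (Suc r) = (let m = rank_bound n r in
     merge_bound (merge_bound (gyarfas_bound m n + gyarfas_bound (Suc m) n + mixed_bound m n + 3)))"

lemma rank_bound_ge: "1 \<le> rank_bound n r"
  by (cases r) (auto simp: Let_def merge_bound_def)

definition structure_bound :: "nat \<Rightarrow> nat" where
  "structure_bound n = rank_bound n (hodges_bound n n + hodges_bound n n)"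

lemma structure_bound_ge: "1 \<le> structure_bound n"
  unfolding structure_bound_def by (rule rank_bound_ge)

section \<open>Alternating decompositions into components, and colorings into decomposable
  pieces\<close>

locale sided_relation =
  fixes sd :: "'z \<Rightarrow> bool" and F :: "'z \<Rightarrow> 'z \<Rightarrow> bool"
  assumes F_sym: "F x y \<Longrightarrow> F y x"
begin

text \<open>\<open>adj False\<close> is the bipartite complement of \<open>adj True\<close>.\<close>

definition adj :: "bool \<Rightarrow> 'z \<Rightarrow> 'z \<Rightarrow> bool" where
  "adj b x y \<longleftrightarrow> sd x \<noteq> sd y \<and> F x y = b"

lemma adj_sym: "adj b x y \<Longrightarrow> adj b y x"
  using F_sym by (auto simp: adj_def)

lemma symp_adj: "symp (adj b)"
  by (auto simp: symp_def adj_sym)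

abbreviation comp :: "bool \<Rightarrow> 'z set \<Rightarrow> 'z \<Rightarrow> 'z set" where
  "comp b \<equiv> component (adj b)"

text \<open>A bipartite analogue of a cotree of height \<open>h\<close>; the flag says in which of
  the two graphs components are taken first.\<close>

fun nice :: "bool \<Rightarrow> nat \<Rightarrow> 'z set \<Rightarrow> bool" where
  "nice b 0 Z \<longleftrightarrow> (\<forall>x\<in>Z. \<forall>y\<in>Z. sd x = sd y)"
| "nice b (Suc h) Z \<longleftrightarrow> (\<forall>x\<in>Z. nice (\<not> b) h (comp b Z x))"

lemma nice_subset: "nice b h Z \<Longrightarrow> Y \<subseteq> Z \<Longrightarrow> nice b h Y"
proof (induction h arbitrary: b Y Z)
  case (Suc h)
  have "nice (\<not> b) h (comp b Y x)" if "x \<in> Y" for x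
    by (rule Suc.IH[of _ "comp b Z x"]) (use Suc.prems that component_mono[OF Suc.prems(2), of "adj b" x] in auto)
  then show ?case by simp
qed auto

lemma nice_flip: "nice b h Z \<Longrightarrow> nice (\<not> b) (Suc h) Z"
  by (simp add: nice_subset[OF _ component_subset])

lemma nice_Suc: "nice b h Z \<Longrightarrow> nice b (Suc h) Z"
proof (induction h arbitrary: b Z)
  case 0
  then show ?case by simp (meson component_subset subsetD)
next
  case (Suc h)
  have "nice (\<not> b) (Suc h) (comp b Z x)" if "x \<in> Z" for x
    by (rule Suc.IH) (use Suc.prems that in simp)
  then show ?case by (simp only: nice.simps(2)[of b "Suc h"]) blast
qed

lemma nice_le: "nice b h Z \<Longrightarrow> h \<le> h' \<Longrightarrow> nice b h' Z"
  by (rotate_tac 1, induction rule: dec_induct) (auto intro: nice_Suc simp del: nice.simps)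

text \<open>One number bounds both colors and rounds, so that the inductions carry a single
  constant. A piece selects its color on each side separately, so any color class of one side may be
  paired with any of the other.\<close>

definition small :: "bool \<Rightarrow> nat \<Rightarrow> 'z set \<Rightarrow> bool" where
  "small b m Z \<longleftrightarrow> (\<exists>g :: 'z \<Rightarrow> nat. (\<forall>z\<in>Z. g z < m) \<and>
     (\<forall>q :: bool \<Rightarrow> nat. nice b m {z\<in>Z. g z = q (sd z)}))"

lemma small_subset: "small b m Z \<Longrightarrow> Y \<subseteq> Z \<Longrightarrow> small b m Y"
  unfolding small_def
  apply (elim exE)
  subgoal for g
    apply (rule exI[of _ g])
    apply (auto intro: nice_subset[where Z = "{z\<in>Z. g z = _ (sd z)}"])
    done
  done

lemma small_le: "small b m Z \<Longrightarrow> m \<le> m' \<Longrightarrow> small b m' Z"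
  unfolding small_def by (meson nice_le order_less_le_trans)

lemma small_flip: "small b m Z \<Longrightarrow> small (\<not> b) (Suc m) Z"
  unfolding small_def by (meson nice_flip less_SucI)

lemma small_one_sided: "\<forall>x\<in>Z. \<forall>y\<in>Z. sd x = sd y \<Longrightarrow> 1 \<le> m \<Longrightarrow> small b m Z"
  unfolding small_def
  by (rule exI[of _ "\<lambda>_. 0"]) (auto intro!: nice_le[of b 0 _ m])

lemma not_small_sides:
  assumes "\<not> small b m Z" "1 \<le> m" obtains z where "z \<in> Z" "sd z = s"
  using small_one_sided[of Z m b] assms by metis

text \<open>On the common side the color is the pair of both old colors, so it can be projected to
  either set. On the other side the color tells whether \<open>g1\<close> or \<open>g2\<close> was
  used. Hence each piece of the union lies in a piece of \<open>Z1\<close> or of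
  \<open>Z2\<close>.\<close>

lemma small_union:
  assumes "small b m Z1" "small b m Z2" and sh: "{z \<in> Z1 \<union> Z2. sd z = s} \<subseteq> Z1 \<inter> Z2"
  shows "small b (merge_bound m) (Z1 \<union> Z2)"
proof -
  obtain g1 where g1: "\<forall>z\<in>Z1. g1 z < m" "\<And>q. nice b m {z\<in>Z1. g1 z = q (sd z)}"
    using assms(1) by (auto simp: small_def)
  obtain g2 where g2: "\<forall>z\<in>Z2. g2 z < m" "\<And>q. nice b m {z\<in>Z2. g2 z = q (sd z)}"
    using assms(2) by (auto simp: small_def)
  define g where "g z = (if sd z = s then g1 z * m + g2 z else if z \<in> Z1 then g1 z else m + g2 z)" for z
  have g: "g z < merge_bound m" if "z \<in> Z1 \<union> Z2" for z
  proof (cases "sd z = s")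
    case True
    then have z: "g1 z < m" "g2 z < m" using that sh g1 g2 by auto
    then have "Suc (g1 z) * m \<le> m * m" by (intro mult_le_mono1) auto
    then have "g1 z * m + g2 z < m * m" using z by simp
    then show ?thesis using True by (simp add: g_def merge_bound_def)
  next
    case False
    then show ?thesis using that g1(1) g2(1) by (auto simp: g_def merge_bound_def trans_less_add2)
  qed
  moreover have "nice b (merge_bound m) {z\<in>Z1 \<union> Z2. g z = q (sd z)}" for q
  proof (cases "q (\<not> s) < m")
    case True
    have "{z\<in>Z1 \<union> Z2. g z = q (sd z)} \<subseteq> {z\<in>Z1. g1 z = (q(s := q s div m)) (sd z)}"
    proof
      fix z assume z: "z \<in> {z\<in>Z1 \<union> Z2. g z = q (sd z)}"
      show "z \<in> {z\<in>Z1. g1 z = (q(s := q s div m)) (sd z)}"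
      proof (cases "sd z = s")
        case True
        then have *: "z \<in> Z1" "g2 z < m" using z sh g2 by auto
        have "q s = g1 z * m + g2 z" using True z by (simp add: g_def)
        then have "q s div m = g1 z" using * by simp
        then show ?thesis using True * by simp
      next
        case False
        then have "sd z = (\<not> s)" by auto
        then show ?thesis using z True by (auto simp: g_def split: if_splits)
      qed
    qed
    from nice_subset[OF g1(2) this] show ?thesis by (rule nice_le[OF _ merge_bound_ge])
  next
    case False
    have "{z\<in>Z1 \<union> Z2. g z = q (sd z)} \<subseteq> {z\<in>Z2. g2 z = (\<lambda>t. if t = s then q s mod m else q t - m) (sd z)}"
    proof
      fix z assume z: "z \<in> {z\<in>Z1 \<union> Z2. g z = q (sd z)}"
      show "z \<in> {z\<in>Z2. g2 z = (\<lambda>t. if t = s then q s mod m else q t - m) (sd z)}"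
      proof (cases "sd z = s")
        case True
        then have *: "z \<in> Z2" "g2 z < m" using z sh g2 by auto
        have "q s = g1 z * m + g2 z" using True z by (simp add: g_def)
        then have "q s mod m = g2 z" using * by simp
        then show ?thesis using True * by simp
      next
        case ne: False
        then have "sd z = (\<not> s)" by auto
        then show ?thesis using z False ne g1(1) by (auto simp: g_def split: if_splits)
      qed
    qed
    from nice_subset[OF g2(2) this] show ?thesis by (rule nice_le[OF _ merge_bound_ge])
  qed
  ultimately show ?thesis unfolding small_def by blast
qed

lemma small_union_le:
  assumes "small b m1 Z1" "small b m2 Z2" "m1 \<le> m" "m2 \<le> m" "{z \<in> Z1 \<union> Z2. sd z = s} \<subseteq> Z1 \<inter> Z2"
  shows "small b (merge_bound m) (Z1 \<union> Z2)"
  by (rule small_union[OF small_le[OF assms(1,3)] small_le[OF assms(2,4)] assms(5)])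

text \<open>Components can be colored independently, since a component of a piece stays inside one
  component of \<open>Z\<close>. Of the two extra rounds, one passes to components and the other
  restores the flag, which that round has flipped.\<close>

lemma small_comps:
  assumes "\<And>x. x \<in> Z \<Longrightarrow> small b m (comp b Z x)"
  shows "small b (m + 2) Z"
proof -
  have "\<exists>g :: 'z \<Rightarrow> nat. (\<forall>z\<in>comp b Z x. g z < m) \<and>
     (\<forall>q. nice b m {z\<in>comp b Z x. g z = q (sd z)})" if "x \<in> Z" for x
    using assms[OF that] by (simp add: small_def)
  then have "\<exists>g :: 'z \<Rightarrow> nat. x \<in> Z \<longrightarrow> (\<forall>z\<in>comp b Z x. g z < m) \<and>
     (\<forall>q. nice b m {z\<in>comp b Z x. g z = q (sd z)})" for x by blast
  \<comment> \<open>The choice is indexed by the component as a set, so that all its vertices use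
    the same coloring.\<close>
  then have "\<forall>C. \<exists>g :: 'z \<Rightarrow> nat. C \<in> comp b Z ` Z \<longrightarrow> (\<forall>z\<in>C. g z < m) \<and> (\<forall>q. nice b m {z\<in>C. g z = q (sd z)})"
    by blast
  from choice[OF this] obtain G :: "'z set \<Rightarrow> 'z \<Rightarrow> nat" where
    G: "\<forall>C. C \<in> comp b Z ` Z \<longrightarrow> (\<forall>z\<in>C. G C z < m) \<and> (\<forall>q. nice b m {z\<in>C. G C z = q (sd z)})"
    by blast
  define g where "g z = G (comp b Z z) z" for z
  have "\<forall>z\<in>Z. g z < m + 2" using G component_refl by (fastforce simp: g_def)
  moreover have "nice b (m + 2) {z\<in>Z. g z = q (sd z)}" for q
  proof -
    let ?Q = "{z\<in>Z. g z = q (sd z)}"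
    have "nice (\<not> b) (Suc m) (comp b ?Q x)" if x: "x \<in> ?Q" for x
    proof -
      have "comp b ?Q x \<subseteq> {z\<in>comp b Z x. G (comp b Z x) z = q (sd z)}"
      proof
        fix z assume z: "z \<in> comp b ?Q x"
        then have "z \<in> comp b Z x" using component_mono[of ?Q Z "adj b" x] by auto
        moreover have "g z = q (sd z)" using z component_subset[of "adj b" ?Q x] by auto
        ultimately show "z \<in> {z\<in>comp b Z x. G (comp b Z x) z = q (sd z)}"
          using component_eq[OF symp_adj] by (auto simp: g_def)
      qed
      moreover have "nice b m {z\<in>comp b Z x. G (comp b Z x) z = q (sd z)}" using G x by blast
      ultimately show ?thesis using nice_flip nice_subset by blast
    qed
    then have "nice b (Suc (Suc m)) ?Q" by (simp only: nice.simps(2)[of b "Suc m"]) blast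
    then show ?thesis by simp
  qed
  ultimately show ?thesis unfolding small_def by blast
qed

section \<open>Simple neighbourhoods: the path argument\<close>

definition connected_set :: "bool \<Rightarrow> 'z set \<Rightarrow> bool" where
  "connected_set b Z \<longleftrightarrow> (\<forall>x\<in>Z. comp b Z x = Z)"

lemma connected_comp: "connected_set b (comp b Z x)"
  by (simp add: connected_set_def component_component[OF symp_adj])

text \<open>Only the side opposite to \<open>v\<close> is thinned out. As the side of
  \<open>v\<close> is kept whole, the sets for \<open>b\<close> and \<open>\<not> b\<close> cover
  \<open>Z\<close> and share a full side, as \<open>small_union\<close> requires.\<close>

definition nb :: "bool \<Rightarrow> 'z \<Rightarrow> 'z set \<Rightarrow> 'z set" where
  "nb b v Z = {z\<in>Z. sd z = sd v \<or> F v z = b}"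

lemma nb_mono: "Y \<subseteq> Z \<Longrightarrow> nb b v Y \<subseteq> nb b v Z"
  by (auto simp: nb_def)

lemma small_nb_mono: "small c m (nb b v Z) \<Longrightarrow> Y \<subseteq> Z \<Longrightarrow> small c m (nb b v Y)"
  using small_subset[OF _ nb_mono] .

lemma nb_subset: "nb b v Z \<subseteq> Z"
  by (auto simp: nb_def)

lemma not_small_nb:
  assumes "\<not> small c (merge_bound (m + M)) Z" "small c m (nb b v Z)"
  shows "\<not> small c M (nb (\<not> b) v Z)"
proof
  assume *: "small c M (nb (\<not> b) v Z)"
  have "nb b v Z \<union> nb (\<not> b) v Z = Z" by (auto simp: nb_def)
  then show False
    using assms small_union_le[OF assms(2) *, of "m + M" "sd v"] by (auto simp: nb_def)
qed

text \<open>Once the neighbours of \<open>v\<close> are removed, a complicated component remains. As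
  \<open>Z\<close> is connected and \<open>x\<close> was removed, some edge leaves this component,
  and its outer end \<open>u\<close> can only be a neighbour of \<open>v\<close>. So
  \<open>u\<close> extends the path while everything later happens among non-neighbours of
  \<open>v\<close>.\<close>

lemma gyarfas_step:
  assumes "connected_set b Z" "x \<in> Z" "adj b v x" "small b m (nb b v Z)"
    "\<not> small b (merge_bound (m + (M + 2))) Z"
  obtains u Z' x' where "u \<in> Z" "adj b v u" "Z' \<subseteq> nb (\<not> b) v Z" "connected_set b Z'"
    "x' \<in> Z'" "adj b u x'" "\<not> small b M Z'"
proof -
  let ?W = "nb (\<not> b) v Z"
  have "\<not> small b (M + 2) ?W" using not_small_nb assms(4,5) by blast
  then obtain x0 where x0: "x0 \<in> ?W" "\<not> small b M (comp b ?W x0)" using small_comps by blast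
  let ?C = "comp b ?W x0"
  have "x0 \<in> Z" using x0 nb_subset by blast
  have xW: "x \<notin> ?W" using assms(3) by (auto simp: nb_def adj_def)
  have "\<exists>y u. y \<in> ?C \<and> u \<in> Z \<and> u \<notin> ?C \<and> adj b y u"
  proof (rule ccontr)
    assume no: "\<not> ?thesis"
    have "x \<in> comp b Z x0" using assms(1,2) \<open>x0 \<in> Z\<close> by (simp add: connected_set_def)
    then have "x \<in> ?C"
    proof (induction rule: component_induct)
      case base
      show ?case by (rule component_refl[OF x0(1)])
    next
      case (step u w)
      then show ?case using no by blast
    qed
    then show False using xW component_subset[of "adj b" ?W x0] by blast
  qed
  then obtain y u where yu: "y \<in> ?C" "u \<in> Z" "u \<notin> ?C" "adj b y u" by blast
  then have "u \<notin> ?W" using component_step[OF yu(1,4)] by blast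
  then have "adj b v u" using yu(2) by (auto simp: nb_def adj_def)
  then show thesis
    by (rule that[OF yu(2) _ component_subset connected_comp yu(1) adj_sym[OF yu(4)] x0(2)])
qed

definition induced_path :: "bool \<Rightarrow> nat \<Rightarrow> 'z set \<Rightarrow> bool" where
  "induced_path b n Z \<longleftrightarrow> (\<exists>p. (\<forall>i\<le>n. p i \<in> Z) \<and>
     (\<forall>i\<le>n. \<forall>j\<le>n. adj b (p i) (p j) \<longleftrightarrow> i = Suc j \<or> j = Suc i))"

lemma induced_path_mono: "induced_path b n Y \<Longrightarrow> Y \<subseteq> Z \<Longrightarrow> induced_path b n Z"
  unfolding induced_path_def by blast

lemma induced_path_le:
  assumes "induced_path b k Z" "l \<le> k" shows "induced_path b l Z"
proof -
  from assms(1) obtain p where "\<forall>i\<le>k. p i \<in> Z" "\<forall>i\<le>k. \<forall>j\<le>k. adj b (p i) (p j) \<longleftrightarrow> i = Suc j \<or> j = Suc i"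
    unfolding induced_path_def by (elim exE conjE) (rule that)
  then show ?thesis
    unfolding induced_path_def using assms(2) by (intro exI[of _ p]) simp
qed

text \<open>The neighbourhood assumption refers to a fixed \<open>Z\<close>, because the current
  endpoint may lie outside the shrinking connected set \<open>Z'\<close>: in the recursive call,
  \<open>u\<close> is a neighbour of \<open>v\<close> whereas \<open>Z2\<close> avoids all of these.
  The same avoidance makes the path induced.\<close>

lemma gyarfas_path:
  assumes "\<And>v. v \<in> Z \<Longrightarrow> small b m (nb b v Z)"
  shows "Z' \<subseteq> Z \<Longrightarrow> connected_set b Z' \<Longrightarrow> v \<in> Z \<Longrightarrow> x \<in> Z' \<Longrightarrow> adj b v x \<Longrightarrow>
    \<not> small b (gyarfas_bound m k) Z' \<Longrightarrow>
    \<exists>p. p 0 = v \<and> (\<forall>i. 0 < i \<and> i \<le> k \<longrightarrow> p i \<in> Z') \<and>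
      (\<forall>i\<le>k. \<forall>j\<le>k. adj b (p i) (p j) \<longleftrightarrow> i = Suc j \<or> j = Suc i)"
proof (induction k arbitrary: Z' v x)
  case 0
  then show ?case by (intro exI[of _ "\<lambda>_. v"]) (auto simp: adj_def)
next
  case (Suc k)
  have "small b m (nb b v Z')" by (rule small_nb_mono[OF assms[OF Suc.prems(3)] Suc.prems(1)])
  then obtain u Z2 x' where u: "u \<in> Z'" "adj b v u" "Z2 \<subseteq> nb (\<not> b) v Z'" "connected_set b Z2"
    "x' \<in> Z2" "adj b u x'" "\<not> small b (gyarfas_bound m k) Z2"
    using gyarfas_step[OF Suc.prems(2) Suc.prems(4) Suc.prems(5)] Suc.prems(6)
    unfolding gyarfas_bound.simps by blast
  have "Z2 \<subseteq> Z'" using u(3) nb_subset by blast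
  then obtain p where p: "p 0 = u" "\<forall>i. 0 < i \<and> i \<le> k \<longrightarrow> p i \<in> Z2"
     "\<forall>i\<le>k. \<forall>j\<le>k. adj b (p i) (p j) \<longleftrightarrow> i = Suc j \<or> j = Suc i"
    using Suc.IH[of Z2 u x'] u Suc.prems(1) by blast
  have v: "adj b v (p j) \<longleftrightarrow> j = 0" if "j \<le> k" for j
  proof (cases "j = 0")
    case True
    then show ?thesis using u p by simp
  next
    case False
    then have "p j \<in> nb (\<not> b) v Z'" using p(2) u(3) that by blast
    then show ?thesis using False by (auto simp: nb_def adj_def)
  qed
  then have v': "adj b (p j) v \<longleftrightarrow> j = 0" if "j \<le> k" for j using that adj_sym by blast
  have vv: "\<not> adj b v v" by (auto simp: adj_def)
  have "\<forall>i\<le>Suc k. \<forall>j\<le>Suc k. adj b (case_nat v p i) (case_nat v p j) \<longleftrightarrow> i = Suc j \<or> j = Suc i"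
    using p(3) v v' vv by (auto split: nat.split)
  moreover have "p i \<in> Z'" if "i \<le> k" for i
    using p(1,2) u(1) \<open>Z2 \<subseteq> Z'\<close> that by (cases "i = 0") auto
  then have "\<forall>i. 0 < i \<and> i \<le> Suc k \<longrightarrow> case_nat v p i \<in> Z'"
    by (auto split: nat.split)
  ultimately show ?case by (intro exI[of _ "case_nat v p"]) simp
qed

lemma small_if_small_neighbourhoods:
  assumes "\<And>v. v \<in> Z \<Longrightarrow> small b m (nb b v Z)" "\<not> induced_path b k Z"
  shows "small b (gyarfas_bound m k + 2) Z"
proof (rule ccontr)
  assume "\<not> ?thesis"
  then obtain x where x: "x \<in> Z" "\<not> small b (gyarfas_bound m k) (comp b Z x)"
    using small_comps by blast
  \<comment> \<open>One-sided sets are always small, so the component meets both sides and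
    \<open>x\<close> has a neighbour at which the path can start.\<close>
  obtain y where y: "y \<in> comp b Z x" "sd y \<noteq> sd x"
    by (rule not_small_sides[OF x(2) gyarfas_bound_ge, of "\<not> sd x"]) auto
  then have "(\<lambda>u v. u \<in> Z \<and> v \<in> Z \<and> adj b u v)\<^sup>*\<^sup>* x y" "x \<noteq> y" by (auto simp: component_def)
  then obtain x1 where x1: "x1 \<in> Z" "adj b x x1" by (auto elim: converse_rtranclpE)
  have "x1 \<in> comp b Z x" by (rule component_step[of x "adj b" Z x x1, OF component_refl[OF x(1)] x1(2,1)])
  then obtain p where p: "p 0 = x" "\<forall>i. 0 < i \<and> i \<le> k \<longrightarrow> p i \<in> comp b Z x"
    "\<forall>i\<le>k. \<forall>j\<le>k. adj b (p i) (p j) \<longleftrightarrow> i = Suc j \<or> j = Suc i"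
    using gyarfas_path[OF assms(1) component_subset connected_comp x(1) _ x1(2) x(2)] by blast
  have "\<forall>i\<le>k. p i \<in> Z" using p(1,2) x(1) component_subset[of "adj b" Z x] by (metis gr0I subsetD)
  then show False using p(3) assms(2) by (auto simp: induced_path_def)
qed

text \<open>Passing to the \<open>b\<close>-neighbours of a vertex on side \<open>s\<close>, or to
  the \<open>b\<close>-non-neighbours of a vertex on the other side, discards only a simple set.
  Doing both in turn gives \<open>v\<close>, adjacent to all that is left opposite to it, and then a
  neighbour \<open>w\<close> of \<open>v\<close>, adjacent to nothing left on side \<open>s\<close>:
  the next pair of a half graph.\<close>

lemma mixed_half_graph:
  assumes "\<And>v. v \<in> Z \<Longrightarrow> sd v = s \<Longrightarrow> small c m (nb (\<not> b) v Z)"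
    and "\<And>v. v \<in> Z \<Longrightarrow> sd v \<noteq> s \<Longrightarrow> small c m (nb b v Z)"
  shows "Z' \<subseteq> Z \<Longrightarrow> \<not> small c (mixed_bound m k) Z' \<Longrightarrow>
    half_graph (adj b) k {z\<in>Z'. sd z \<noteq> s} {z\<in>Z'. sd z = s}"
proof (induction k arbitrary: Z')
  case 0
  then show ?case by (simp add: half_graph_0)
next
  case (Suc k)
  let ?M = "mixed_bound m k"
  have M: "1 \<le> ?M" by (rule mixed_bound_ge)
  then have M': "1 \<le> merge_bound (m + ?M)" by (intro merge_bound_pos) simp
  obtain v where v: "v \<in> Z'" "sd v = s"
    using not_small_sides[OF Suc.prems(2) mixed_bound_ge] by blast
  have "small c m (nb (\<not> b) v Z')" 
    using small_nb_mono[OF assms(1)[OF _ v(2)] Suc.prems(1)] v Suc.prems(1) by blast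
  then have Z1: "\<not> small c (merge_bound (m + ?M)) (nb b v Z')"
    using not_small_nb[of c m _ Z' "\<not> b" v] Suc.prems(2) by simp
  then obtain w where w: "w \<in> nb b v Z'" "sd w \<noteq> s" using not_small_sides[OF _ M', of c _ "\<not> s"] by blast
  then have wZ: "w \<in> Z'" using nb_subset by blast
  have "small c m (nb b w (nb b v Z'))"
    using small_nb_mono[OF assms(2)[OF _ w(2)], of "nb b v Z'"] wZ nb_subset Suc.prems(1) by blast
  then have Z2: "\<not> small c ?M (nb (\<not> b) w (nb b v Z'))" using not_small_nb Z1 by blast
  have "half_graph (adj b) k {z\<in>nb (\<not> b) w (nb b v Z'). sd z \<noteq> s} {z\<in>nb (\<not> b) w (nb b v Z'). sd z = s}"
    using Suc.IH[OF _ Z2] nb_subset Suc.prems(1) by blast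
  then have "half_graph (adj b) k {y\<in>{z\<in>Z'. sd z \<noteq> s}. adj b y v} {x\<in>{z\<in>Z'. sd z = s}. \<not> adj b w x}"
    by (rule half_graph_mono) (use v w F_sym in \<open>auto simp: nb_def adj_def\<close>)
  moreover have "adj b w v" using w v F_sym by (auto simp: nb_def adj_def)
  ultimately show ?case using v w wZ by (intro half_graph_Suc[of "adj b" k _ v _ w]) auto
qed

lemma small_if_mixed:
  assumes "\<And>v. v \<in> Z \<Longrightarrow> sd v = s \<Longrightarrow> small c m (nb (\<not> b) v Z)"
    and "\<And>v. v \<in> Z \<Longrightarrow> sd v \<noteq> s \<Longrightarrow> small c m (nb b v Z)"
    and "\<not> half_graph (adj b) k Z Z"
  shows "small c (mixed_bound m k) Z"
  using mixed_half_graph[of Z s c m b Z k, OF assms(1,2)] assms(3) half_graph_mono[of "adj b" k] 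
  by blast

text \<open>Each side is split according to which of the two neighbourhoods is known to be simple.
  Equal choices on both sides are settled by the path argument, in the graph or in its complement;
  opposite choices by the half graph. In the complement the flag changes before and after the
  argument, whence \<open>Suc m\<close> and the summand 3.\<close>

lemma small_if_unbalanced:
  assumes bal: "\<And>v. v \<in> Z \<Longrightarrow> small True m (nb True v Z) \<or> small True m (nb False v Z)"
    and "\<And>b. \<not> induced_path b n Z" "\<not> half_graph (adj True) n Z Z"
  defines "M \<equiv> gyarfas_bound m n + gyarfas_bound (Suc m) n + mixed_bound m n + 3"
  shows "small True (merge_bound (merge_bound M)) Z"
proof -
  define \<tau> where "\<tau> v \<longleftrightarrow> small True m (nb True v Z)" for v
  define P where "P q = {z\<in>Z. \<tau> z = q (sd z)}" for q :: "bool \<Rightarrow> bool"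
  have PZ: "P q \<subseteq> Z" for q unfolding P_def by blast
  have \<tau>: "small True m (nb (\<tau> v) v (P q))" if "v \<in> P q" for v q
  proof -
    have "v \<in> Z" using that PZ by blast
    then have "small True m (nb (\<tau> v) v Z)" using bal[of v] by (cases "\<tau> v") (simp_all add: \<tau>_def)
    then show ?thesis by (rule small_nb_mono[OF _ PZ])
  qed
  have no: "\<not> induced_path b n (P q)" "\<not> half_graph (adj True) n (P q) (P q)" for b q
    using assms(2,3) induced_path_mono[OF _ PZ] half_graph_mono[OF _ PZ PZ] by blast+
  have sm: "small True M (P q)" for q
  proof -
    consider "q True" "q False" | "\<not> q True" "\<not> q False" | "q True" "\<not> q False" | "\<not> q True" "q False"
      by blast
    then show ?thesis
    proof cases
      case 1
      then have "q s" for s by (cases s) auto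
      then have "small True m (nb True v (P q))" if "v \<in> P q" for v
        using \<tau>[OF that] that by (auto simp: P_def)
      then have "small True (gyarfas_bound m n + 2) (P q)" using small_if_small_neighbourhoods no by blast
      then show ?thesis by (rule small_le) (simp add: M_def)
    next
      case 2
      then have "\<not> q s" for s by (cases s) auto
      then have "small True m (nb False v (P q))" if "v \<in> P q" for v
        using \<tau>[OF that] that by (auto simp: P_def)
      then have "small False (Suc m) (nb False v (P q))" if "v \<in> P q" for v
        using small_flip[of True] that by simp
      then have "small False (gyarfas_bound (Suc m) n + 2) (P q)"
        using small_if_small_neighbourhoods no by blast
      then have "small True (Suc (gyarfas_bound (Suc m) n + 2)) (P q)" using small_flip[of False] by simp
      then show ?thesis by (rule small_le) (simp add: M_def)
    next
      case 3
      have "small True m (nb (\<not> True) v (P q))" if "v \<in> P q" "sd v = False" for v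
        using \<tau>[OF that(1)] that 3 by (auto simp: P_def)
      moreover have "small True m (nb True v (P q))" if "v \<in> P q" "sd v \<noteq> False" for v
        using \<tau>[OF that(1)] that 3 by (auto simp: P_def)
      ultimately have "small True (mixed_bound m n) (P q)" using small_if_mixed no by blast
      then show ?thesis by (rule small_le) (simp add: M_def)
    next
      case 4
      have "small True m (nb (\<not> True) v (P q))" if "v \<in> P q" "sd v = True" for v
        using \<tau>[OF that(1)] that 4 by (auto simp: P_def)
      moreover have "small True m (nb True v (P q))" if "v \<in> P q" "sd v \<noteq> True" for v
        using \<tau>[OF that(1)] that 4 by (auto simp: P_def)
      ultimately have "small True (mixed_bound m n) (P q)" using small_if_mixed no by blast
      then show ?thesis by (rule small_le) (simp add: M_def)
    qed
  qed
  \<comment> \<open>The four parts are merged in two stages: the two parts of \<open>W t\<close>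
    share their vertices on side \<open>True\<close>, and then \<open>W True\<close> and
    \<open>W False\<close> share side \<open>False\<close>. This is the double
    \<open>merge_bound\<close>.\<close>
  define W where "W t = {z\<in>Z. sd z \<longrightarrow> \<tau> z = t}" for t
  have "small True (merge_bound M) (W t)" for t
  proof -
    have "P (\<lambda>s. if s then t else True) \<union> P (\<lambda>s. if s then t else False) = W t"
      by (auto simp: P_def W_def)
    moreover have "{z \<in> P (\<lambda>s. if s then t else True) \<union> P (\<lambda>s. if s then t else False). sd z = True}
      \<subseteq> P (\<lambda>s. if s then t else True) \<inter> P (\<lambda>s. if s then t else False)" by (auto simp: P_def)
    ultimately show ?thesis using small_union[OF sm sm, of "\<lambda>s. if s then t else True"
      "\<lambda>s. if s then t else False" True] by simp
  qed
  moreover have "W True \<union> W False = Z" "{z \<in> W True \<union> W False. sd z = False} \<subseteq> W True \<inter> W False"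
    by (auto simp: W_def)
  ultimately show ?thesis using small_union[of True _ "W True" "W False" False] by simp
qed

text \<open>There is one rank for tests from each side. If neighbourhood and non-neighbourhood of
  \<open>v\<close> both kept enough rank, \<open>v\<close> would be the root of a forbidden tree; so
  one of them has smaller rank and is small by induction, while the other rank does not grow under
  restriction. If a rank bound is 0, one side is empty.\<close>

lemma small_if_rank:
  assumes "\<And>b. \<not> induced_path b n Z" "\<not> half_graph (adj True) n Z Z"
    and "\<not> tree_rank_ge F r1 {z\<in>Z. sd z} {z\<in>Z. \<not> sd z}"
    and "\<not> tree_rank_ge F r2 {z\<in>Z. \<not> sd z} {z\<in>Z. sd z}"
  shows "small True (rank_bound n (r1 + r2)) Z"
  using assms
proof (induction "r1 + r2" arbitrary: r1 r2 Z)
  case 0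
  then show ?case by (intro small_one_sided) auto
next
  case (Suc r)
  show ?case
  proof (cases "r1 = 0 \<or> r2 = 0")
    case True
    then show ?thesis using Suc.prems(3,4) by (intro small_one_sided rank_bound_ge) auto
  next
    case False
    then obtain s1 s2 where s: "r1 = Suc s1" "r2 = Suc s2" by (meson not0_implies_Suc)
    have k: "r = s1 + r2" "r = r1 + s2" using Suc.hyps(2) s by auto
    have IH: "small True (rank_bound n r) (nb b v Z)" if
      *: "t1 + t2 = r" "\<not> tree_rank_ge F t1 {z\<in>nb b v Z. sd z} {z\<in>nb b v Z. \<not> sd z}"
      "\<not> tree_rank_ge F t2 {z\<in>nb b v Z. \<not> sd z} {z\<in>nb b v Z. sd z}" for b v t1 t2
    proof -
      have "\<not> induced_path c n (nb b v Z)" for c using Suc.prems(1) induced_path_mono[OF _ nb_subset] by blast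
      moreover have "\<not> half_graph (adj True) n (nb b v Z) (nb b v Z)"
        using Suc.prems(2) half_graph_mono[OF _ nb_subset nb_subset] by blast
      ultimately show ?thesis using Suc.hyps(1)[OF *(1)[symmetric], of "nb b v Z"] * by simp
    qed
    have sub1: "\<not> tree_rank_ge F r1 {z\<in>nb b v Z. sd z} {z\<in>nb b v Z. \<not> sd z}" for b v
      using Suc.prems(3) tree_rank_ge_mono[where Y' = "{z\<in>Z. sd z}" and Z' = "{z\<in>Z. \<not> sd z}"]
        nb_subset[of b v Z] by blast
    have sub2: "\<not> tree_rank_ge F r2 {z\<in>nb b v Z. \<not> sd z} {z\<in>nb b v Z. sd z}" for b v
      using Suc.prems(4) tree_rank_ge_mono[where Y' = "{z\<in>Z. \<not> sd z}" and Z' = "{z\<in>Z. sd z}"]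
        nb_subset[of b v Z] by blast
    have "small True (rank_bound n r) (nb True v Z) \<or> small True (rank_bound n r) (nb False v Z)"
      if v: "v \<in> Z" for v
    proof (cases "sd v")
      case True
      then have *: "{z\<in>nb b v Z. sd z} = {z\<in>Z. sd z}"
        "{z\<in>nb b v Z. \<not> sd z} = {z\<in>{z\<in>Z. \<not> sd z}. F v z = b}" for b
        by (auto simp: nb_def)
      have "\<exists>b. \<not> tree_rank_ge F s1 {z\<in>Z. sd z} {z\<in>{z\<in>Z. \<not> sd z}. F v z = b}"
      proof (rule ccontr)
        assume "\<not> ?thesis"
        then have "tree_rank_ge F s1 {z\<in>Z. sd z} {z\<in>{z\<in>Z. \<not> sd z}. F v z = b}" for b by blast
        from this[of True] this[of False] show False
          using Suc.prems(3) v True unfolding s by auto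
      qed
      then obtain b where "\<not> tree_rank_ge F s1 {z\<in>Z. sd z} {z\<in>{z\<in>Z. \<not> sd z}. F v z = b}" ..
      then have "small True (rank_bound n r) (nb b v Z)"
        by (intro IH[OF k(1)[symmetric] _ sub2]) (simp only: * not_False_eq_True)
      then show ?thesis by (cases b) auto
    next
      case False
      then have *: "{z\<in>nb b v Z. \<not> sd z} = {z\<in>Z. \<not> sd z}"
        "{z\<in>nb b v Z. sd z} = {z\<in>{z\<in>Z. sd z}. F v z = b}" for b
        by (auto simp: nb_def)
      have "\<exists>b. \<not> tree_rank_ge F s2 {z\<in>Z. \<not> sd z} {z\<in>{z\<in>Z. sd z}. F v z = b}"
      proof (rule ccontr)
        assume "\<not> ?thesis"
        then have "tree_rank_ge F s2 {z\<in>Z. \<not> sd z} {z\<in>{z\<in>Z. sd z}. F v z = b}" for b by blast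
        from this[of True] this[of False] show False
          using Suc.prems(4) v False unfolding s by auto
      qed
      then obtain b where "\<not> tree_rank_ge F s2 {z\<in>Z. \<not> sd z} {z\<in>{z\<in>Z. sd z}. F v z = b}" ..
      then have "small True (rank_bound n r) (nb b v Z)"
        by (intro IH[OF k(2)[symmetric] sub1]) (simp only: * not_False_eq_True)
      then show ?thesis by (cases b) auto
    qed
    then have "small True (rank_bound n (Suc r)) Z"
      using small_if_unbalanced[of Z "rank_bound n r" n] Suc.prems(1,2) by (simp add: Let_def)
    then show ?thesis using Suc.hyps(2) by simp
  qed
qed

lemma small_if_no_patterns:
  assumes "\<And>b. \<not> induced_path b n Z" "\<And>b. \<not> half_graph (adj b) n Z Z"
  shows "small True (structure_bound n) Z"
  unfolding structure_bound_def
proof (rule small_if_rank)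
  have "\<not> tree_rank_ge F (hodges_bound n n) {z\<in>Z. sd z = s} {z\<in>Z. sd z = (\<not> s)}" for s
  proof
    assume "tree_rank_ge F (hodges_bound n n) {z\<in>Z. sd z = s} {z\<in>Z. sd z = (\<not> s)}"
    then have "half_graph F n {z\<in>Z. sd z = s} {z\<in>Z. sd z = (\<not> s)} \<or>
        half_graph (\<lambda>x y. \<not> F x y) n {z\<in>Z. sd z = s} {z\<in>Z. sd z = (\<not> s)}"
      by (rule half_graph_if_tree_rank_ge)
    then have "half_graph (adj True) n Z Z \<or> half_graph (adj False) n Z Z"
      unfolding half_graph_def adj_def by (elim disj_forward ex_forward) auto
    then show False using assms(2) by blast
  qed
  from this[of True] this[of False]
  show "\<not> tree_rank_ge F (hodges_bound n n) {z\<in>Z. sd z} {z\<in>Z. \<not> sd z}"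
    "\<not> tree_rank_ge F (hodges_bound n n) {z\<in>Z. \<not> sd z} {z\<in>Z. sd z}"
    by auto
qed (use assms in auto)

end

section \<open>Elimination of equivalence classes\<close>

definition linked :: "('v \<Rightarrow> 's \<Rightarrow> 'k) \<Rightarrow> 's set \<Rightarrow> 'k set \<Rightarrow> 'v \<Rightarrow> 'v \<Rightarrow> bool" where
  "linked cl S D u w \<longleftrightarrow> (\<exists>s\<in>S. \<exists>t\<in>S. cl u s = cl w t \<and> cl u s \<notin> D)"

text \<open>A path in the bipartite incidence graph of vertices and undeleted classes:
  \<open>a i\<close> and \<open>b i\<close> are the slots by which positions \<open>i\<close> and
  \<open>Suc i\<close> lie in the class between them.\<close>

definition class_path ::
    "('v \<Rightarrow> 's \<Rightarrow> 'k) \<Rightarrow> 's set \<Rightarrow> 'k set \<Rightarrow> 'v set \<Rightarrow> nat \<Rightarrow> 'v \<Rightarrow> bool" where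
  "class_path cl S D X n v \<longleftrightarrow> (\<exists>p a b. p 0 = v \<and> inj_on p {..n} \<and> (\<forall>i\<le>n. p i \<in> X) \<and>
     (\<forall>i<n. a i \<in> S \<and> b i \<in> S \<and> cl (p i) (a i) = cl (p (Suc i)) (b i) \<and> cl (p i) (a i) \<notin> D) \<and>
     inj_on (\<lambda>i. cl (p i) (a i)) {..<n})"

lemma symp_linked: "symp (linked cl S D)"
  by (auto simp: symp_def linked_def) metis

text \<open>The old path avoids all classes of \<open>v\<close>, so the class linking
  \<open>v\<close> to \<open>y\<close> cannot recur on it.\<close>

lemma class_path_Cons:
  assumes "class_path cl S (D \<union> cl v ` S) X n y" "v \<notin> X" "s \<in> S" "t \<in> S" "cl v s = cl y t" "cl v s \<notin> D"
  shows "class_path cl S D (insert v X) (Suc n) v"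
proof -
  obtain p a b where p: "p 0 = y" "inj_on p {..n}" "\<forall>i\<le>n. p i \<in> X"
    "\<forall>i<n. a i \<in> S \<and> b i \<in> S \<and> cl (p i) (a i) = cl (p (Suc i)) (b i) \<and> cl (p i) (a i) \<notin> D \<union> cl v ` S"
    "inj_on (\<lambda>i. cl (p i) (a i)) {..<n}"
    using assms(1) by (auto simp: class_path_def)
  let ?p = "case_nat v p" and ?a = "case_nat s a" and ?b = "case_nat t b"
  have "inj_on ?p {..Suc n}"
    using p(2,3) assms(2) by (fastforce simp: inj_on_def split: nat.splits)
  moreover have "inj_on (\<lambda>i. cl (?p i) (?a i)) {..<Suc n}"
  proof -
    have "cl (p i) (a i) \<noteq> cl v s" if "i < n" for i
    proof -
      have "cl v s \<in> cl v ` S" using assms(3) by simp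
      then show ?thesis using p(4) that by (metis UnI2)
    qed
    then show ?thesis using p(5) by (fastforce simp: inj_on_def split: nat.splits)
  qed
  moreover have "\<forall>i<Suc n. ?a i \<in> S \<and> ?b i \<in> S \<and> cl (?p i) (?a i) = cl (?p (Suc i)) (?b i) \<and> cl (?p i) (?a i) \<notin> D"
    using p(1,4) assms(3-) by (auto split: nat.split)
  moreover have "\<forall>i\<le>Suc n. ?p i \<in> insert v X"
    using p(3) by (auto split: nat.split)
  ultimately show ?thesis unfolding class_path_def by (intro exI[of _ ?p] exI[of _ ?a] exI[of _ ?b] conjI)
      (assumption | simp)+
qed

lemma class_path_mono: "class_path cl S D X n v \<Longrightarrow> X \<subseteq> Y \<Longrightarrow> class_path cl S D Y n v"
  unfolding class_path_def by blast

text \<open>\<open>R d x\<close> names the node at depth \<open>d\<close> above \<open>x\<close> and is itself the vertex whose classes are deleted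
  there, so a class shared across a branching is a class of a vertex naming a common ancestor.\<close>

definition layering ::
    "('v \<Rightarrow> 's \<Rightarrow> 'k) \<Rightarrow> 's set \<Rightarrow> 'k set \<Rightarrow> 'v set \<Rightarrow> nat \<Rightarrow> (nat \<Rightarrow> 'v \<Rightarrow> 'v) \<Rightarrow> bool" where
  "layering cl S D X n R \<longleftrightarrow>
     (\<forall>x\<in>X. \<forall>y\<in>X. R 0 x = R 0 y) \<and>
     (\<forall>d. \<forall>x\<in>X. R d x \<in> X) \<and>
     (\<forall>d. \<forall>x\<in>X. \<forall>y\<in>X. R (Suc d) x = R (Suc d) y \<longrightarrow> R d x = R d y) \<and>
     (\<forall>x\<in>X. \<forall>y\<in>X. R n x = R n y \<longrightarrow> x = y) \<and>
     (\<forall>d. \<forall>x\<in>X. \<forall>y\<in>X. \<forall>s\<in>S. \<forall>t\<in>S. R d x = R d y \<and> R (Suc d) x \<noteq> R (Suc d) y \<and>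
        cl x s = cl y t \<and> cl x s \<notin> D \<longrightarrow> (\<exists>e\<le>d. \<exists>r\<in>S. cl (R e x) r = cl x s))"

lemma
  assumes "layering cl S D X n R"
  shows layering_root: "x \<in> X \<Longrightarrow> y \<in> X \<Longrightarrow> R 0 x = R 0 y"
    and layering_in: "x \<in> X \<Longrightarrow> R d x \<in> X"
    and layering_refine: "x \<in> X \<Longrightarrow> y \<in> X \<Longrightarrow> R (Suc d) x = R (Suc d) y \<Longrightarrow> R d x = R d y"
    and layering_inj: "x \<in> X \<Longrightarrow> y \<in> X \<Longrightarrow> R n x = R n y \<Longrightarrow> x = y"
    and layering_separate: "x \<in> X \<Longrightarrow> y \<in> X \<Longrightarrow> s \<in> S \<Longrightarrow> t \<in> S \<Longrightarrow> R d x = R d y \<Longrightarrow>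
      R (Suc d) x \<noteq> R (Suc d) y \<Longrightarrow> cl x s = cl y t \<Longrightarrow> cl x s \<notin> D \<Longrightarrow>
      \<exists>e\<le>d. \<exists>r\<in>S. cl (R e x) r = cl x s"
proof -
  note * = assms[unfolded layering_def]
  show "x \<in> X \<Longrightarrow> y \<in> X \<Longrightarrow> R 0 x = R 0 y" by (rule *[THEN conjunct1, rule_format])
  note * = *[THEN conjunct2]
  show "x \<in> X \<Longrightarrow> R d x \<in> X" by (rule *[THEN conjunct1, rule_format])
  note * = *[THEN conjunct2]
  show "x \<in> X \<Longrightarrow> y \<in> X \<Longrightarrow> R (Suc d) x = R (Suc d) y \<Longrightarrow> R d x = R d y"
    by (rule *[THEN conjunct1, rule_format])
  note * = *[THEN conjunct2]
  show "x \<in> X \<Longrightarrow> y \<in> X \<Longrightarrow> R n x = R n y \<Longrightarrow> x = y" by (rule *[THEN conjunct1, rule_format])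
  note * = *[THEN conjunct2]
  show "x \<in> X \<Longrightarrow> y \<in> X \<Longrightarrow> s \<in> S \<Longrightarrow> t \<in> S \<Longrightarrow> R d x = R d y \<Longrightarrow>
      R (Suc d) x \<noteq> R (Suc d) y \<Longrightarrow> cl x s = cl y t \<Longrightarrow> cl x s \<notin> D \<Longrightarrow>
      \<exists>e\<le>d. \<exists>r\<in>S. cl (R e x) r = cl x s"
    by (rule *[rule_format]) simp_all
qed

lemma layering_refine_le:
  assumes lay: "layering cl S D X n R" and de: "d \<le> e" and X: "u \<in> X" "w \<in> X" and eq: "R e u = R e w"
  shows "R d u = R d w"
  using de eq by (induction rule: inc_induct) (auto intro: layering_refine[OF lay X])

text \<open>Depth-first elimination, as for treedepth: \<open>v\<close> becomes the root and its
  classes are deleted. Every remaining component is entered from \<open>v\<close> through a deleted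
  class, at a vertex whose paths in the component extend to longer paths from \<open>v\<close>; so
  the path bound drops by one.\<close>

lemma layering_exists:
  assumes "v \<in> X" "component (linked cl S D) X v = X" "\<not> class_path cl S D X n v"
  shows "\<exists>R. layering cl S D X n R"
  using assms
proof (induction n arbitrary: v X D)
  case 0
  then have "class_path cl S D X 0 v"
    unfolding class_path_def by (intro exI[of _ "\<lambda>_. v"]) auto
  then show ?case using 0 by blast
next
  case (Suc n)
  define D' where "D' = D \<union> cl v ` S"
  define Y where "Y = X - {v}"
  define K where "K x = component (linked cl S D') Y x" for x
  have XY: "X = insert v Y" "v \<notin> Y" using Suc.prems(1) by (auto simp: Y_def)
  have K_refl: "x \<in> K x" if "x \<in> Y" for x using that by (simp add: K_def component_refl)
  have K_sub: "K x \<subseteq> Y" for x by (simp add: K_def component_subset)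
  have K_eq: "K y = K x" if "y \<in> K x" for x y
    using that unfolding K_def by (rule component_eq[OF symp_linked])
  \<comment> \<open>On a chain of links from \<open>v\<close>, the last link using a class of
    \<open>v\<close> enters the component, and the chain stays in it afterwards.\<close>
  have entry: "\<exists>y\<in>K x. \<exists>s\<in>S. \<exists>t\<in>S. cl v s = cl y t \<and> cl v s \<notin> D" if "x \<in> Y" for x
  proof -
    have "x \<in> component (linked cl S D) X v" using that XY Suc.prems(2) by auto
    then have "x \<noteq> v \<longrightarrow> (\<exists>y\<in>K x. \<exists>s\<in>S. \<exists>t\<in>S. cl v s = cl y t \<and> cl v s \<notin> D)"
    proof (induction rule: component_induct)
      case (step u w)
      show ?case
      proof
        assume "w \<noteq> v"
        then have w: "w \<in> Y" using step(2) XY by blast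
        obtain s t where st: "s \<in> S" "t \<in> S" "cl u s = cl w t" "cl u s \<notin> D"
          using step(3) by (auto simp: linked_def)
        show "\<exists>y\<in>K w. \<exists>s\<in>S. \<exists>t\<in>S. cl v s = cl y t \<and> cl v s \<notin> D"
        proof (cases "cl u s \<in> D'")
          case True
          then obtain r where "r \<in> S" "cl u s = cl v r" using st(4) by (auto simp: D'_def)
          then have "cl v r = cl w t" "cl v r \<notin> D" using st by auto
          then show ?thesis using \<open>r \<in> S\<close> st(2) K_refl[OF w] by blast
        next
          case False
          then have "u \<noteq> v" using st(1) by (auto simp: D'_def)
          then have u: "u \<in> Y" using component_subset[THEN subsetD, OF step(1)] XY by blast
          have "linked cl S D' u w" using st False by (auto simp: linked_def)
          then have "w \<in> K u" using component_step[OF K_refl[OF u, unfolded K_def] _ w] by (simp add: K_def)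
          then have "K w = K u" by (rule K_eq)
          then show ?thesis using step.IH \<open>u \<noteq> v\<close> by simp
        qed
      qed
    qed auto
    then show ?thesis using that XY by auto
  qed
  have "\<exists>R. layering cl S D' C n R" if C: "C \<in> K ` Y" for C
  proof -
    obtain x where x: "x \<in> Y" "C = K x" using C by blast
    obtain y s t where y: "y \<in> K x" "s \<in> S" "t \<in> S" "cl v s = cl y t" "cl v s \<notin> D"
      using entry[OF x(1)] by blast
    have "component (linked cl S D') (K x) y = K x"
      using component_component[OF symp_linked y(1)[unfolded K_def]] by (simp only: K_def)
    moreover have "\<not> class_path cl S D' (K x) n y"
    proof
      assume *: "class_path cl S D' (K x) n y"
      have "v \<notin> K x" using K_sub XY by blast
      from class_path_Cons[OF *[unfolded D'_def] this y(2-)] have "class_path cl S D X (Suc n) v"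
        by (rule class_path_mono) (use K_sub XY(1) in blast)
      then show False using Suc.prems(3) by blast
    qed
    ultimately show ?thesis using Suc.IH[of y C D'] y(1) x(2) by blast
  qed
  then have "\<forall>C. \<exists>R. C \<in> K ` Y \<longrightarrow> layering cl S D' C n R" by blast
  from choice[OF this] obtain Q where Q: "\<And>C. C \<in> K ` Y \<Longrightarrow> layering cl S D' C n (Q C)" by blast
  \<comment> \<open>\<open>v\<close> names itself on every layer and thus forms its own branch below
    the root; all other vertices use the layers of their component, shifted by one.\<close>
  define R where "R d x = (if d = 0 \<or> x = v then v else Q (K x) (d - 1) x)" for d x
  have R0: "R 0 x = v" and Rv: "R d v = v" for d x by (auto simp: R_def)
  have RS: "R (Suc d) x = Q (K x) d x" if "x \<in> Y" for d x using that XY by (auto simp: R_def)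
  have lay: "layering cl S D' (K x) n (Q (K x))" if "x \<in> Y" for x
    by (rule Q[OF imageI[OF that]])
  have RK: "R (Suc d) x \<in> K x" if "x \<in> Y" for d x
    using layering_in[OF lay[OF that] K_refl[OF that]] RS[OF that] by simp
  have Keq: "K x = K y" if "x \<in> Y" "y \<in> Y" "R (Suc d) x = R (Suc d) y" for x y d
    using K_eq[OF RK[OF that(1), of d]] K_eq[OF RK[OF that(2), of d]] that(3) by simp
  have RSv: "x = v \<longleftrightarrow> R (Suc d) x = v" if "x \<in> X" for x d
  proof
    assume "R (Suc d) x = v"
    then show "x = v" using RK[of x d] K_sub[of x] XY that by auto
  qed (simp add: Rv)
  have inX: "R d x \<in> X" if "x \<in> X" for d x
  proof (cases "d = 0 \<or> x = v")
    case True
    then show ?thesis using Suc.prems(1) by (auto simp: R0 Rv)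
  next
    case False
    then have "x \<in> Y" "d = Suc (d - 1)" using that XY(1) by auto
    then show ?thesis using RK[of x "d - 1"] K_sub[of x] XY(1) by auto
  qed
  have refine: "R d x = R d y" if xy: "x \<in> X" "y \<in> X" "R (Suc d) x = R (Suc d) y" for d x y
  proof (cases "d = 0 \<or> x = v \<or> y = v")
    case True
    then show ?thesis using xy RSv[of x d] RSv[of y d] by (auto simp: R0 Rv)
  next
    case False
    then have xY: "x \<in> Y" "y \<in> Y" using xy XY(1) by auto
    obtain e where d: "d = Suc e" using False by (cases d) auto
    have "y \<in> K x" using K_refl[OF xY(2)] Keq[OF xY xy(3)] by simp
    then show ?thesis
      using layering_refine[OF lay[OF xY(1)] K_refl[OF xY(1)], of y e] Keq[OF xY xy(3)] xy(3)
      by (simp add: d RS xY)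
  qed
  have inj: "x = y" if xy: "x \<in> X" "y \<in> X" "R (Suc n) x = R (Suc n) y" for x y
  proof (cases "x = v \<or> y = v")
    case True
    then show ?thesis using xy RSv[of x n] RSv[of y n] by (auto simp: Rv)
  next
    case False
    then have xY: "x \<in> Y" "y \<in> Y" using xy XY by auto
    have "y \<in> K x" using K_refl[OF xY(2)] Keq[OF xY xy(3)] by simp
    then show ?thesis
      using layering_inj[OF lay[OF xY(1)] K_refl[OF xY(1)], of y] Keq[OF xY xy(3)] xy(3)
      by (simp add: RS xY)
  qed
  \<comment> \<open>The shared class either belongs to \<open>v\<close>, which is found at depth 0,
    or survives the deletion and puts both vertices into one component, where the induction
    hypothesis applies.\<close>
  have sep: "\<exists>e\<le>d. \<exists>r\<in>S. cl (R e x) r = cl x s"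
    if xy: "x \<in> X" "y \<in> X" "s \<in> S" "t \<in> S" "R d x = R d y" "R (Suc d) x \<noteq> R (Suc d) y"
      "cl x s = cl y t" "cl x s \<notin> D" for d x y s t
  proof (cases "cl x s \<in> D'")
    case True
    then show ?thesis using xy(8) by (intro exI[of _ 0]) (auto simp: D'_def R0)
  next
    case False
    have "cl v s \<in> D'" "cl v t \<in> D'" using xy(3,4) by (auto simp: D'_def)
    then have "x \<noteq> v" "y \<noteq> v" using False xy(7) by auto
    then have xY: "x \<in> Y" "y \<in> Y" using xy(1,2) XY(1) by auto
    have "linked cl S D' x y" using xy False by (auto simp: linked_def)
    then have yK: "y \<in> K x"
      using component_step[OF K_refl[OF xY(1), unfolded K_def] _ xY(2)] by (simp add: K_def)
    then have KK: "K y = K x" by (rule K_eq)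
    show ?thesis
    proof (cases d)
      case 0
      then show ?thesis
        using xy(6) layering_root[OF lay[OF xY(1)] K_refl[OF xY(1)] yK] KK by (simp add: RS xY)
    next
      case (Suc e)
      have "Q (K x) e x = Q (K x) e y" "Q (K x) (Suc e) x \<noteq> Q (K x) (Suc e) y"
        using xy(5,6) KK by (simp_all add: Suc RS xY)
      then obtain e' r where "e' \<le> e" "r \<in> S" "cl (Q (K x) e' x) r = cl x s"
        using layering_separate[OF lay[OF xY(1)] K_refl[OF xY(1)] yK xy(3,4) _ _ xy(7) False] by blast
      then show ?thesis by (intro exI[of _ "Suc e'"]) (auto simp: Suc RS xY)
    qed
  qed
  have "layering cl S D X (Suc n) R"
    unfolding layering_def by (intro conjI allI ballI impI; (elim conjE)?) (fact R0 inX refine inj sep | simp add: R0)+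
  then show ?case by (rule exI[of _ R])
qed

section \<open>Tree models from layers\<close>

lemma graph_isoI:
  assumes "pair_wf_digraph G" "bij_betw \<phi> (pverts G) (pverts H)" "parcs H \<subseteq> pverts H \<times> pverts H"
    and "\<And>u v. u \<in> pverts G \<Longrightarrow> v \<in> pverts G \<Longrightarrow> (u, v) \<in> parcs G \<longleftrightarrow> (\<phi> u, \<phi> v) \<in> parcs H"
  shows "graph_iso G H"
proof -
  interpret G: pair_wf_digraph G by fact
  define f where "f = \<lparr>iso_verts = \<phi>, iso_arcs = map_prod \<phi> \<phi>, iso_head = snd, iso_tail = fst\<rparr>"
  have inj: "inj_on \<phi> (pverts G)" and im: "\<phi> ` pverts G = pverts H" using assms(2) by (auto simp: bij_betw_def)
  have arcs: "parcs G \<subseteq> pverts G \<times> pverts G" using G.in_arcsD1 G.in_arcsD2 by auto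
  have "inj_on (map_prod \<phi> \<phi>) (parcs G)"
    by (rule inj_on_subset[OF map_prod_inj_on[OF inj inj] arcs])
  then have "pre_digraph.digraph_isomorphism (with_proj G) f"
    using inj G.wf_digraph_axioms
    by (auto simp: pre_digraph.digraph_isomorphism_def f_def with_proj_def)
  moreover have "map_prod \<phi> \<phi> ` parcs G = parcs H"
  proof
    show "map_prod \<phi> \<phi> ` parcs G \<subseteq> parcs H" using arcs assms(4) by auto
    show "parcs H \<subseteq> map_prod \<phi> \<phi> ` parcs G"
    proof
      fix e assume e: "e \<in> parcs H"
      then obtain u v where "u \<in> pverts G" "v \<in> pverts G" "e = (\<phi> u, \<phi> v)"
        using assms(3) im by (cases e) blast
      then show "e \<in> map_prod \<phi> \<phi> ` parcs G"
        using assms(4)[of u v] e by (auto intro!: image_eqI[of _ _ "(u, v)"])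
    qed
  qed
  then have "with_proj H = app_iso f (with_proj G)"
    by (simp add: app_iso_def f_def with_proj_def im)
  ultimately show ?thesis unfolding digraph_iso_def by blast
qed

lemma switch_point:
  fixes n :: nat
  assumes "P 0" "\<not> P n" shows "\<exists>d<n. P d \<and> \<not> P (Suc d)"
  using assms by (induction n) (auto intro: less_SucI)

text \<open>\<open>node\<close> numbers pairs of a depth and a label, because the same label can
  recur at several depths. All leaves lie at depth exactly \<open>n\<close>.\<close>

locale layered_set =
  fixes V :: "'v set" and R :: "nat \<Rightarrow> 'v \<Rightarrow> 'w" and n :: nat and node :: "nat \<Rightarrow> 'v \<Rightarrow> nat"
  assumes fin: "finite V" and ne: "V \<noteq> {}"
    and R_root: "u \<in> V \<Longrightarrow> w \<in> V \<Longrightarrow> R 0 u = R 0 w"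
    and R_refine: "u \<in> V \<Longrightarrow> w \<in> V \<Longrightarrow> R (Suc d) u = R (Suc d) w \<Longrightarrow> R d u = R d w"
    and R_inj: "u \<in> V \<Longrightarrow> w \<in> V \<Longrightarrow> R n u = R n w \<Longrightarrow> u = w"
    and node_eq: "d \<le> n \<Longrightarrow> e \<le> n \<Longrightarrow> u \<in> V \<Longrightarrow> w \<in> V \<Longrightarrow>
      node d u = node e w \<longleftrightarrow> d = e \<and> R d u = R d w"
begin

definition layer_tree :: "nat pair_pre_digraph" where
  "layer_tree = \<lparr> pverts = {node d u | d u. d \<le> n \<and> u \<in> V},
     parcs = {(node d u, node (Suc d) u) | d u. d < n \<and> u \<in> V} \<rparr>"

lemma node_in_layer_tree: "d \<le> n \<Longrightarrow> u \<in> V \<Longrightarrow> node d u \<in> pverts layer_tree"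
  unfolding layer_tree_def by auto

lemma arc_in_layer_tree: "d < n \<Longrightarrow> u \<in> V \<Longrightarrow> (node d u, node (Suc d) u) \<in> parcs layer_tree"
  unfolding layer_tree_def by auto

lemma R_refine_le: "d \<le> e \<Longrightarrow> u \<in> V \<Longrightarrow> w \<in> V \<Longrightarrow> R e u = R e w \<Longrightarrow> R d u = R d w"
  by (induction rule: inc_induct) (auto intro: R_refine)

lemma wf_layer_tree: "pair_fin_digraph layer_tree"
proof
  show "fst e \<in> pverts layer_tree" "snd e \<in> pverts layer_tree" if e: "e \<in> parcs layer_tree" for e
  proof -
    obtain d u where "e = (node d u, node (Suc d) u)" "d < n" "u \<in> V"
      using e by (auto simp: layer_tree_def)
    then show "fst e \<in> pverts layer_tree" "snd e \<in> pverts layer_tree"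
      by (auto simp: layer_tree_def) (metis Suc_leI less_imp_le)+
  qed
  have "pverts layer_tree = (\<lambda>(d, u). node d u) ` ({..n} \<times> V)" by (auto simp: layer_tree_def)
  then show "finite (pverts layer_tree)" using fin by simp
  have "parcs layer_tree = (\<lambda>(d, u). (node d u, node (Suc d) u)) ` ({..<n} \<times> V)"
    by (auto simp: layer_tree_def)
  then show "finite (parcs layer_tree)" using fin by simp
qed

interpretation T: pair_fin_digraph layer_tree by (rule wf_layer_tree)

text \<open>A walk can only follow the branch of some vertex \<open>w\<close> below its start. This
  closed form yields uniqueness of walks, the height and the ancestor relation at once.\<close>

lemma awalk_layer_tree:
  assumes "d \<le> n" "u \<in> V"
  shows "pre_digraph.awalk (with_proj layer_tree) (node d u) p v \<longleftrightarrow>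
    (\<exists>w\<in>V. \<exists>e. d \<le> e \<and> e \<le> n \<and> R d u = R d w \<and> v = node e w \<and>
      p = map (\<lambda>i. (node i w, node (Suc i) w)) [d..<e])"
  using assms
proof (induction p arbitrary: d u)
  case Nil
  have "node d u \<in> pverts layer_tree" using Nil by (rule node_in_layer_tree)
  then have "T.awalk (node d u) [] v \<longleftrightarrow> v = node d u" by (auto simp: T.awalk_Nil_iff)
  also have "\<dots> \<longleftrightarrow> (\<exists>w\<in>V. \<exists>e. d \<le> e \<and> e \<le> n \<and> R d u = R d w \<and> v = node e w \<and>
      [] = map (\<lambda>i. (node i w, node (Suc i) w)) [d..<e])"
  proof
    assume "v = node d u"
    then show "\<exists>w\<in>V. \<exists>e. d \<le> e \<and> e \<le> n \<and> R d u = R d w \<and> v = node e w \<and>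
      [] = map (\<lambda>i. (node i w, node (Suc i) w)) [d..<e]"
      using Nil by (intro bexI[of _ u] exI[of _ d]) auto
  next
    assume "\<exists>w\<in>V. \<exists>e. d \<le> e \<and> e \<le> n \<and> R d u = R d w \<and> v = node e w \<and>
      [] = map (\<lambda>i. (node i w, node (Suc i) w)) [d..<e]"
    then obtain w e where w: "w \<in> V" "d \<le> e" "e \<le> n" "R d u = R d w" "v = node e w"
      "[] = map (\<lambda>i. (node i w, node (Suc i) w)) [d..<e]"
      by (elim bexE exE conjE) (rule that)
    then have "e = d" by auto
    then show "v = node d u" using w node_eq[of d d u w] Nil by simp
  qed
  finally show ?case .
next
  case (Cons a p)
  show ?case
  proof
    assume "T.awalk (node d u) (a # p) v"
    then have a: "a \<in> parcs layer_tree" "node d u = fst a" "T.awalk (snd a) p v"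
      by (auto simp: T.awalk_Cons_iff)
    then obtain d0 u0 where u0: "a = (node d0 u0, node (Suc d0) u0)" "d0 < n" "u0 \<in> V"
      by (auto simp: layer_tree_def)
    then have d: "d0 = d" "R d u = R d u0" using a(2) node_eq[of d d0 u u0] Cons.prems by auto
    obtain w e where w: "w \<in> V" "Suc d \<le> e" "e \<le> n" "R (Suc d) u0 = R (Suc d) w" "v = node e w"
      "p = map (\<lambda>i. (node i w, node (Suc i) w)) [Suc d..<e]"
    proof -
      have "T.awalk (node (Suc d) u0) p v" using a(3) u0(1) d(1) by simp
      then show ?thesis using Cons.IH[of "Suc d" u0] u0 d(1) that by auto
    qed
    have Rd: "R d u0 = R d w" using R_refine[OF u0(3) w(1,4)] .
    then have "a = (node d w, node (Suc d) w)"
      using u0 d(1) w(1-4) node_eq[of d d u0 w] node_eq[of "Suc d" "Suc d" u0 w] by simp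
    moreover have "[d..<e] = d # [Suc d..<e]" using w(2) by (simp add: upt_conv_Cons)
    ultimately have "a # p = map (\<lambda>i. (node i w, node (Suc i) w)) [d..<e]" using w(6) by simp
    then show "\<exists>w\<in>V. \<exists>e. d \<le> e \<and> e \<le> n \<and> R d u = R d w \<and> v = node e w \<and>
      a # p = map (\<lambda>i. (node i w, node (Suc i) w)) [d..<e]"
      using w(1-3,5) d(2) Rd by (intro bexI[OF _ w(1)] exI[of _ e] conjI) simp_all
  next
    assume "\<exists>w\<in>V. \<exists>e. d \<le> e \<and> e \<le> n \<and> R d u = R d w \<and> v = node e w \<and>
      a # p = map (\<lambda>i. (node i w, node (Suc i) w)) [d..<e]"
    then obtain w e where w: "w \<in> V" "d \<le> e" "e \<le> n" "R d u = R d w" "v = node e w"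
      "a # p = map (\<lambda>i. (node i w, node (Suc i) w)) [d..<e]"
      by (elim bexE exE conjE) (rule that)
    then have "d < e" by (cases "d < e") simp_all
    then have "[d..<e] = d # [Suc d..<e]" by (simp add: upt_conv_Cons)
    then have a: "a = (node d w, node (Suc d) w)" "p = map (\<lambda>i. (node i w, node (Suc i) w)) [Suc d..<e]"
      using w(6) by simp_all
    have "T.awalk (node (Suc d) w) p v"
    proof -
      have "Suc d \<le> n" using \<open>d < e\<close> w(3) by simp
      moreover have "Suc d \<le> e" using \<open>d < e\<close> by simp
      ultimately show ?thesis using Cons.IH[of "Suc d" w] w(1,3,5) a(2) by blast
    qed
    moreover have "d < n" using \<open>d < e\<close> w(3) by simp
    then have "a \<in> parcs layer_tree" unfolding a(1) using w(1) by (rule arc_in_layer_tree)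
    moreover have "node d u = node d w" using node_eq w Cons.prems by simp
    ultimately show "T.awalk (node d u) (a # p) v" using a(1) by (simp add: T.awalk_Cons_iff)
  qed
qed

lemma pverts_layer_treeE:
  assumes "v \<in> pverts layer_tree" obtains d u where "v = node d u" "d \<le> n" "u \<in> V"
  using assms by (auto simp: layer_tree_def)

lemma rooted_layer_tree:
  assumes "u0 \<in> V" shows "rooted_tree layer_tree (node 0 u0)"
  unfolding rooted_tree_def
proof (intro conjI ballI)
  show "pair_fin_digraph layer_tree" by (rule wf_layer_tree)
  show "node 0 u0 \<in> pverts layer_tree" using assms by (simp add: node_in_layer_tree)
  fix v assume "v \<in> pverts layer_tree"
  then obtain d u where v: "v = node d u" "d \<le> n" "u \<in> V" by (rule pverts_layer_treeE)
  note aw = awalk_layer_tree[OF le0 assms, of _ v]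
  show "\<exists>!p. T.awalk (node 0 u0) p v"
  proof (rule ex1I)
    show "T.awalk (node 0 u0) (map (\<lambda>i. (node i u, node (Suc i) u)) [0..<d]) v"
      unfolding aw using v R_root[OF assms v(3)] by (intro bexI[of _ u] exI[of _ d]) simp_all
    fix p assume "T.awalk (node 0 u0) p v"
    then obtain w e where w: "w \<in> V" "e \<le> n" "v = node e w"
      "p = map (\<lambda>i. (node i w, node (Suc i) w)) [0..<e]"
      unfolding aw by auto
    then have e: "e = d" "R d u = R d w" using node_eq[of d e u w] v by auto
    have "node i w = node i u" if "i \<le> d" for i
      using node_eq[of i i w u] R_refine_le[OF that v(3) w(1) e(2)] that v w by simp
    then show "p = map (\<lambda>i. (node i u, node (Suc i) u)) [0..<d]"
      unfolding w(4) e(1) by (intro map_cong) auto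
  qed
qed

lemma height_layer_tree:
  assumes "u0 \<in> V" shows "height_at_most layer_tree (node 0 u0) n"
  unfolding height_at_most_def using awalk_layer_tree[OF le0 assms] by auto

lemma ancestor_layer_tree:
  assumes "d \<le> n" "e \<le> n" "u \<in> V" "w \<in> V"
  shows "ancestor layer_tree (node d u) (node e w) \<longleftrightarrow> d \<le> e \<and> R d u = R d w"
proof -
  have "ancestor layer_tree (node d u) (node e w) \<longleftrightarrow> (\<exists>p. T.awalk (node d u) p (node e w))"
    by (rule T.reachable_awalk)
  also have "\<dots> \<longleftrightarrow> d \<le> e \<and> R d u = R d w"
    unfolding awalk_layer_tree[OF assms(1,3)]
  proof
    assume "\<exists>p. \<exists>w'\<in>V. \<exists>e'. d \<le> e' \<and> e' \<le> n \<and> R d u = R d w' \<and> node e w = node e' w' \<and>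
      p = map (\<lambda>i. (node i w', node (Suc i) w')) [d..<e']"
    then obtain w' e' where w': "w' \<in> V" "d \<le> e'" "e' \<le> n" "R d u = R d w'" "node e w = node e' w'"
      by (elim bexE exE conjE) (rule that)
    then have "e = e'" "R e w = R e w'" using node_eq[of e e' w w'] assms by auto
    then show "d \<le> e \<and> R d u = R d w" using w' R_refine_le[of d e w w'] assms by auto
  qed (use assms in blast)
  finally show ?thesis .
qed

lemma leaves_layer_tree: "leaves layer_tree = node n ` V"
proof -
  have "(\<forall>w. (node d u, w) \<notin> parcs layer_tree) \<longleftrightarrow> d = n" if "d \<le> n" "u \<in> V" for d u
  proof
    assume *: "\<forall>w. (node d u, w) \<notin> parcs layer_tree"
    show "d = n"
    proof (rule ccontr)
      assume "d \<noteq> n"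
      then have "(node d u, node (Suc d) u) \<in> parcs layer_tree"
        using that by (intro arc_in_layer_tree) auto
      then show False using * by blast
    qed
  next
    assume "d = n"
    then show "\<forall>w. (node d u, w) \<notin> parcs layer_tree"
      using that by (auto simp: layer_tree_def node_eq)
  qed
  then show ?thesis unfolding leaves_def by (auto elim!: pverts_layer_treeE intro: node_in_layer_tree)
qed

lemma lca_layer_tree:
  assumes "u \<in> V" "w \<in> V" "d < n" "R d u = R d w" "R (Suc d) u \<noteq> R (Suc d) w"
  shows "lca layer_tree (node n u) (node n w) = node d u"
  unfolding lca_def
proof (rule the_equality)
  have anc: "x = node e z \<Longrightarrow> e \<le> n \<Longrightarrow> z \<in> V \<Longrightarrow>
      ancestor layer_tree x (node n u) \<Longrightarrow> ancestor layer_tree x (node n w) \<Longrightarrow>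
      e \<le> d \<and> R e z = R e u" for x e z
  proof -
    assume x: "x = node e z" "e \<le> n" "z \<in> V" "ancestor layer_tree x (node n u)" "ancestor layer_tree x (node n w)"
    then have "R e z = R e u" "R e z = R e w" using ancestor_layer_tree assms by auto
    moreover have "\<not> Suc d \<le> e" using R_refine_le[of "Suc d" e u w] assms calculation by auto
    ultimately show "e \<le> d \<and> R e z = R e u" by auto
  qed
  have vert: "\<exists>e z. x = node e z \<and> e \<le> n \<and> z \<in> V" if "ancestor layer_tree x y" for x y
  proof -
    have "x \<in> pverts layer_tree" using T.reachable_in_verts(1)[OF that] .
    then show ?thesis by (rule pverts_layer_treeE) blast
  qed
  have du: "ancestor layer_tree (node d u) (node n u)" "ancestor layer_tree (node d u) (node n w)"
    using ancestor_layer_tree assms by auto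
  show "ancestor layer_tree (node d u) (node n u) \<and> ancestor layer_tree (node d u) (node n w) \<and>
     (\<forall>x. ancestor layer_tree x (node n u) \<and> ancestor layer_tree x (node n w) \<longrightarrow>
        ancestor layer_tree x (node d u))"
  proof (intro conjI du allI impI)
    fix x assume x: "ancestor layer_tree x (node n u) \<and> ancestor layer_tree x (node n w)"
    then obtain e z where e: "x = node e z" "e \<le> n" "z \<in> V" using vert by blast
    then show "ancestor layer_tree x (node d u)" using anc[OF e] x ancestor_layer_tree assms by auto
  qed
  fix x assume x: "ancestor layer_tree x (node n u) \<and> ancestor layer_tree x (node n w) \<and>
     (\<forall>y. ancestor layer_tree y (node n u) \<and> ancestor layer_tree y (node n w) \<longrightarrow>
        ancestor layer_tree y x)"
  then obtain e z where e: "x = node e z" "e \<le> n" "z \<in> V" using vert by blast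
  then have "e \<le> d" "R e z = R e u" using anc[OF e] x by auto
  moreover have "ancestor layer_tree (node d u) (node e z)" using x du e(1) by blast
  then have "d \<le> e" using ancestor_layer_tree assms e by auto
  ultimately show "x = node d u" using e node_eq assms by auto
qed

text \<open>By \<open>det\<close>, adjacency depends only on the depth of branching and the two
  colors. Hence a single edge branching at a node decides all pairs that branch there with the same
  colors.\<close>

lemma tree_model_layer_tree:
  assumes G: "pair_graph G" and V: "pverts G = V"
    and col: "\<And>u. u \<in> V \<Longrightarrow> col u \<in> {1..k}"
    and det: "\<And>d u w u' w'. u \<in> V \<Longrightarrow> w \<in> V \<Longrightarrow> u' \<in> V \<Longrightarrow> w' \<in> V \<Longrightarrow> R d u = R d w \<Longrightarrow>
      R (Suc d) u \<noteq> R (Suc d) w \<Longrightarrow> R d u' = R d w' \<Longrightarrow> R (Suc d) u' \<noteq> R (Suc d) w' \<Longrightarrow>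
      col u = col u' \<Longrightarrow> col w = col w' \<Longrightarrow> (u, w) \<in> parcs G \<Longrightarrow> (u', w') \<in> parcs G"
  shows "\<exists>(T :: nat pair_pre_digraph) r c f. tree_model k n T r c f \<and> graph_iso G (model_graph T c f)"
proof -
  interpret G: pair_graph G by fact
  obtain u0 where u0: "u0 \<in> V" using ne by blast
  have inj: "inj_on (node n) V" using node_eq R_inj by (auto simp: inj_on_def)
  define c where "c = col \<circ> the_inv_into V (node n)"
  \<comment> \<open>Symmetrized in the colors, as tree models demand; an edge found in the reverse
    order is turned around before \<open>det\<close> is applied.\<close>
  define f where "f x i j \<longleftrightarrow> (\<exists>u\<in>V. \<exists>w\<in>V. (u, w) \<in> parcs G \<and> lca layer_tree (node n u) (node n w) = x \<and>
     (col u = i \<and> col w = j \<or> col u = j \<and> col w = i))" for x i j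
  have c: "c (node n u) = col u" if "u \<in> V" for u
    using that inj by (simp add: c_def the_inv_into_f_f)
  have "tree_model k n layer_tree (node 0 u0) c f"
    unfolding tree_model_def using rooted_layer_tree[OF u0] height_layer_tree[OF u0] col c
    by (auto simp: leaves_layer_tree f_def)
  moreover have "graph_iso G (model_graph layer_tree c f)"
  proof (rule graph_isoI)
    show "pair_wf_digraph G" by unfold_locales
    show "bij_betw (node n) (pverts G) (pverts (model_graph layer_tree c f))"
      using inj by (simp add: model_graph_def leaves_layer_tree bij_betw_def V)
    show "parcs (model_graph layer_tree c f) \<subseteq>
        pverts (model_graph layer_tree c f) \<times> pverts (model_graph layer_tree c f)"
      by (auto simp: model_graph_def)
    fix u w assume "u \<in> pverts G" "w \<in> pverts G"
    then have uw: "u \<in> V" "w \<in> V" by (simp_all add: V)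
    have neq: "node n u \<noteq> node n w \<longleftrightarrow> u \<noteq> w" using inj uw by (auto dest: inj_onD)
    have split: "\<exists>d<n. R d u = R d w \<and> R (Suc d) u \<noteq> R (Suc d) w" if "u \<in> V" "w \<in> V" "u \<noteq> w" for u w
      by (rule switch_point) (use that R_root R_inj in blast)+
    have "(u, w) \<in> parcs G \<longleftrightarrow> u \<noteq> w \<and> f (lca layer_tree (node n u) (node n w)) (col u) (col w)"
    proof
      assume "(u, w) \<in> parcs G"
      then show "u \<noteq> w \<and> f (lca layer_tree (node n u) (node n w)) (col u) (col w)"
        using uw G.no_loops' by (auto simp: f_def)
    next
      assume *: "u \<noteq> w \<and> f (lca layer_tree (node n u) (node n w)) (col u) (col w)"
      then obtain x y where xy: "x \<in> V" "y \<in> V" "(x, y) \<in> parcs G"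
        "lca layer_tree (node n x) (node n y) = lca layer_tree (node n u) (node n w)"
        "col x = col u \<and> col y = col w \<or> col x = col w \<and> col y = col u"
        unfolding f_def by blast
      obtain d where d: "d < n" "R d u = R d w" "R (Suc d) u \<noteq> R (Suc d) w" using split[OF uw] * by blast
      obtain e where e: "e < n" "R e x = R e y" "R (Suc e) x \<noteq> R (Suc e) y"
        using split[OF xy(1,2)] G.no_loops'[OF xy(3)] by blast
      have "node e x = node d u" using xy(4) lca_layer_tree[OF uw d] lca_layer_tree[OF xy(1,2) e] by simp
      then have ed: "e = d" using node_eq[of e d x u] d e xy uw by simp
      have "(y, x) \<in> parcs G" using xy(3) G.arcs_symmetric by blast
      then show "(u, w) \<in> parcs G"
        using xy(5) det[OF xy(1,2) uw _ _ d(2,3)] det[OF xy(2,1) uw _ _ d(2,3)] xy(3) e unfolding ed by metis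
    qed
    then show "(u, w) \<in> parcs G \<longleftrightarrow> (node n u, node n w) \<in> parcs (model_graph layer_tree c f)"
      using uw by (simp add: model_graph_def leaves_layer_tree c neq)
  qed
  ultimately show ?thesis by blast
qed

end

lemma tree_model_if_layers:
  fixes R :: "nat \<Rightarrow> 'v \<Rightarrow> 'w"
  assumes G: "pair_graph G" "pverts G = V" "V \<noteq> {}"
    and R: "\<And>u w. u \<in> V \<Longrightarrow> w \<in> V \<Longrightarrow> R 0 u = R 0 w"
      "\<And>d u w. u \<in> V \<Longrightarrow> w \<in> V \<Longrightarrow> R (Suc d) u = R (Suc d) w \<Longrightarrow> R d u = R d w"
      "\<And>u w. u \<in> V \<Longrightarrow> w \<in> V \<Longrightarrow> R n u = R n w \<Longrightarrow> u = w"
    and col: "\<And>u. u \<in> V \<Longrightarrow> col u \<in> {1..k}"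
    and det: "\<And>d u w u' w'. u \<in> V \<Longrightarrow> w \<in> V \<Longrightarrow> u' \<in> V \<Longrightarrow> w' \<in> V \<Longrightarrow> R d u = R d w \<Longrightarrow>
      R (Suc d) u \<noteq> R (Suc d) w \<Longrightarrow> R d u' = R d w' \<Longrightarrow> R (Suc d) u' \<noteq> R (Suc d) w' \<Longrightarrow>
      col u = col u' \<Longrightarrow> col w = col w' \<Longrightarrow> (u, w) \<in> parcs G \<Longrightarrow> (u', w') \<in> parcs G"
  shows "\<exists>(T :: nat pair_pre_digraph) r c f. tree_model k n T r c f \<and> graph_iso G (model_graph T c f)"
proof -
  interpret G: pair_graph G by fact
  have fin: "finite V" using G.pair_finite_verts G(2) by simp
  let ?N = "(\<lambda>(d, u). (d, R d u)) ` ({..n} \<times> V)"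
  have "finite ?N" using fin by simp
  then obtain g :: "nat \<times> 'w \<Rightarrow> nat" where g: "inj_on g ?N" using finite_imp_inj_to_nat_seg[of ?N] by auto
  have g_eq: "g (d, R d u) = g (e, R e w) \<longleftrightarrow> d = e \<and> R d u = R d w"
    if "d \<le> n" "e \<le> n" "u \<in> V" "w \<in> V" for d e u w
  proof -
    have "(d, R d u) \<in> ?N" "(e, R e w) \<in> ?N" using that by auto
    then show ?thesis using inj_on_eq_iff[OF g] by auto
  qed
  have "layered_set V R n (\<lambda>d u. g (d, R d u))"
    by (rule layered_set.intro[OF fin G(3) R g_eq])
  from layered_set.tree_model_layer_tree[OF this G(1,2) col det] show ?thesis by simp
qed

section \<open>Definable binary queries\<close>

type_synonym 'a query = "'a pair_pre_digraph \<Rightarrow> (nat \<Rightarrow> 'a set) \<Rightarrow> 'a \<Rightarrow> 'a \<Rightarrow> bool"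

text \<open>The formula is given for every pair of variables, so that queries can be composed
  through a fresh variable without a renaming operation on formulas.\<close>

definition represents :: "(nat \<Rightarrow> nat \<Rightarrow> fo) \<Rightarrow> 'a query \<Rightarrow> bool" where
  "represents \<phi> Q \<longleftrightarrow> (\<forall>x y. free_vars (\<phi> x y) \<subseteq> {x, y} \<and>
     (\<forall>G P s. sat G P s (\<phi> x y) \<longleftrightarrow> Q G P (s x) (s y)))"

definition definable :: "'a query \<Rightarrow> bool" where
  "definable Q \<longleftrightarrow> (\<exists>\<phi>. represents \<phi> Q)"

lemma definableI:
  assumes "\<And>x y. free_vars (\<phi> x y) \<subseteq> {x, y}" "\<And>x y G P s. sat G P s (\<phi> x y) \<longleftrightarrow> Q G P (s x) (s y)"
  shows "definable Q"
  unfolding definable_def represents_def by (rule exI[of _ \<phi>]) (simp add: assms)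

lemma representsD:
  assumes "represents \<phi> Q"
  shows "free_vars (\<phi> x y) \<subseteq> {x, y}" "sat G P s (\<phi> x y) \<longleftrightarrow> Q G P (s x) (s y)"
  using assms by (simp_all add: represents_def)

lemma definable_eq: "definable (\<lambda>G P a b. a = b)"
  by (rule definableI[of Eq]) auto

lemma definable_edge: "definable (\<lambda>G P a b. (a, b) \<in> parcs G)"
  by (rule definableI[of Edge]) auto

lemma definable_pred1: "definable (\<lambda>G P a b. a \<in> P i)"
  by (rule definableI[of "\<lambda>x y. Pred i x"]) auto

lemma definable_pred2: "definable (\<lambda>G P a b. b \<in> P i)"
  by (rule definableI[of "\<lambda>x y. Pred i y"]) auto

lemma definable_not:
  assumes "definable Q" shows "definable (\<lambda>G P a b. \<not> Q G P a b)"
proof -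
  obtain \<phi> where "represents \<phi> Q" using assms by (auto simp: definable_def)
  note \<phi> = representsD[OF this]
  then show ?thesis by (intro definableI[of "\<lambda>x y. Neg (\<phi> x y)"]) simp_all
qed

lemma definable_conj:
  assumes "definable Q1" "definable Q2" shows "definable (\<lambda>G P a b. Q1 G P a b \<and> Q2 G P a b)"
proof -
  obtain \<phi>1 where "represents \<phi>1 Q1" using assms(1) by (auto simp: definable_def)
  note 1 = representsD[OF this]
  obtain \<phi>2 where "represents \<phi>2 Q2" using assms(2) by (auto simp: definable_def)
  note 2 = representsD[OF this]
  show ?thesis
    by (rule definableI[of "\<lambda>x y. Conj (\<phi>1 x y) (\<phi>2 x y)"]) (use 1 2 in simp_all)
qed

lemma definable_disj:
  assumes "definable Q1" "definable Q2" shows "definable (\<lambda>G P a b. Q1 G P a b \<or> Q2 G P a b)"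
  using definable_not[OF definable_conj[OF definable_not[OF assms(1)] definable_not[OF assms(2)]]]
  by simp

lemma definable_const: "definable (\<lambda>G P a b. c)"
proof (cases c)
  case True
  show ?thesis by (rule definableI[of "\<lambda>x y. Eq x x"]) (use True in auto)
next
  case False
  show ?thesis by (rule definableI[of "\<lambda>x y. Neg (Eq x x)"]) (use False in auto)
qed

lemma definable_iff_const:
  assumes "definable Q" shows "definable (\<lambda>G P a b. Q G P a b = c)"
  using assms definable_not[OF assms] by (cases c) auto

lemma definable_compose:
  assumes "definable Q1" "definable Q2"
  shows "definable (\<lambda>G P a b. \<exists>c\<in>pverts G. Q1 G P a c \<and> Q2 G P c b)"
proof -
  obtain \<phi>1 where "represents \<phi>1 Q1" using assms(1) by (auto simp: definable_def)
  note 1 = representsD[OF this]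
  obtain \<phi>2 where "represents \<phi>2 Q2" using assms(2) by (auto simp: definable_def)
  note 2 = representsD[OF this]
  \<comment> \<open>\<open>Suc (x + y)\<close> is distinct from both \<open>x\<close> and
    \<open>y\<close>.\<close>
  let ?\<psi> = "\<lambda>x y. Ex (Suc (x + y)) (Conj (\<phi>1 x (Suc (x + y))) (\<phi>2 (Suc (x + y)) y))"
  show ?thesis
  proof (rule definableI[of ?\<psi>])
    fix x y
    show "free_vars (?\<psi> x y) \<subseteq> {x, y}"
      using 1(1)[of x "Suc (x + y)"] 2(1)[of "Suc (x + y)" y] by auto
    show "sat G P s (?\<psi> x y) \<longleftrightarrow> (\<exists>c\<in>pverts G. Q1 G P (s x) c \<and> Q2 G P c (s y))" for G P s
      by (simp add: 1(2) 2(2))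
  qed
qed

lemma definable_Bex:
  assumes "finite S" "\<And>s. s \<in> S \<Longrightarrow> definable (Q s)"
  shows "definable (\<lambda>G P a b. \<exists>s\<in>S. Q s G P a b)"
  using assms
proof (induction S rule: finite_induct)
  case empty
  show ?case using definable_const[of False] by simp
next
  case (insert x S)
  then show ?case using definable_disj[of "Q x" "\<lambda>G P a b. \<exists>s\<in>S. Q s G P a b"] by simp
qed

lemma wf_path_graph: "pair_wf_digraph (path_graph n)"
  by unfold_locales (auto simp: path_graph_def)

text \<open>\<open>P 0\<close> is reserved for the output vertices, so one vertex formula serves
  every query. \<open>Q\<close> may be directed, since transductions symmetrize edges.\<close>

definition realizes_path :: "'a query \<Rightarrow> 'a pair_pre_digraph \<Rightarrow> nat \<Rightarrow> bool" where
  "realizes_path Q G n \<longleftrightarrow> (\<exists>P u. coloring G P \<and> inj_on u {..<n} \<and> P 0 = u ` {..<n} \<and>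
     (\<forall>i<n. \<forall>j<n. i \<noteq> j \<longrightarrow> (Q G P (u i) (u j) \<or> Q G P (u j) (u i) \<longleftrightarrow> j = Suc i \<or> i = Suc j)))"

lemma realizes_pathI:
  assumes "coloring G P" "inj_on u {..<n}" "P 0 = u ` {..<n}"
    "\<And>i j. i < n \<Longrightarrow> j < n \<Longrightarrow> i \<noteq> j \<Longrightarrow>
      Q G P (u i) (u j) \<or> Q G P (u j) (u i) \<longleftrightarrow> j = Suc i \<or> i = Suc j"
  shows "realizes_path Q G n"
  unfolding realizes_path_def using assms by (intro exI[of _ P] exI[of _ u] conjI allI impI)

text \<open>One transduction is tested on the whole class, so a path it misses is missed on every
  graph of \<open>C\<close>; this makes the bound uniform.\<close>

lemma definable_path_bound:
  fixes C :: "'a pair_pre_digraph set"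
  assumes "definable Q" "\<not> fo_transducible_from all_paths C"
  shows "\<exists>n\<ge>1. \<forall>G\<in>C. \<not> realizes_path Q G n"
proof -
  obtain \<phi> where "represents \<phi> Q" using assms(1) by (auto simp: definable_def)
  note \<phi> = representsD[OF this]
  define T where "T = \<lparr>vert_fm = Pred 0 0, edge_fm = \<phi> 0 1\<rparr>"
  have "fo_transduction T" using \<phi>(1) by (simp add: fo_transduction_def T_def)
  then obtain H where "H \<in> all_paths" "\<forall>H'\<in>transduce_class T C. \<not> graph_iso H H'"
    using assms(2) unfolding fo_transducible_from_def by blast
  then obtain n where n: "n \<ge> 1" "\<forall>H'\<in>transduce_class T C. \<not> graph_iso (path_graph n) H'"
    by (auto simp: all_paths_def)
  have "\<not> realizes_path Q G n" if G: "G \<in> C" for G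
  proof
    assume "realizes_path Q G n"
    then obtain P u where P: "coloring G P" and u: "inj_on u {..<n}" "P 0 = u ` {..<n}"
      and Q: "\<forall>i<n. \<forall>j<n. i \<noteq> j \<longrightarrow>
        (Q G P (u i) (u j) \<or> Q G P (u j) (u i) \<longleftrightarrow> j = Suc i \<or> i = Suc j)"
      unfolding realizes_path_def by (elim exE conjE) (rule that)
    let ?H = "transduction_output T G P"
    have "?H \<in> transduce_class T C" using G P by (auto simp: transduce_class_def transduce_def)
    moreover have "graph_iso (path_graph n) ?H"
    proof (rule graph_isoI[OF wf_path_graph])
      have "P 0 \<subseteq> pverts G" using P by (simp add: coloring_def)
      then have W: "{v \<in> pverts G. holds_vert T G P v} = u ` {..<n}"
        using u(2) by (auto simp: holds_vert_def T_def)
      have vH: "pverts ?H = u ` {..<n}" by (simp add: transduction_output_def W)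
      show "bij_betw u (pverts (path_graph n)) (pverts ?H)"
        using u(1) by (simp add: vH path_graph_def bij_betw_def)
      show "parcs ?H \<subseteq> pverts ?H \<times> pverts ?H" by (auto simp: transduction_output_def Let_def)
      fix i j assume "i \<in> pverts (path_graph n)" "j \<in> pverts (path_graph n)"
      then have ij: "i < n" "j < n" by (simp_all add: path_graph_def)
      have "holds_edge T G P v w \<longleftrightarrow> Q G P v w" for v w by (simp add: holds_edge_def T_def \<phi>(2))
      then have "(u i, u j) \<in> parcs ?H \<longleftrightarrow> u i \<noteq> u j \<and> (Q G P (u i) (u j) \<or> Q G P (u j) (u i))"
        using ij by (simp add: transduction_output_def W Let_def)
      also have "\<dots> \<longleftrightarrow> i \<noteq> j \<and> (j = Suc i \<or> i = Suc j)"
      proof (cases "i = j")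
        case False
        then have "u i \<noteq> u j" using inj_on_eq_iff[OF u(1)] ij by simp
        then show ?thesis using Q[rule_format, OF ij False] False by simp
      qed simp
      finally show "(i, j) \<in> parcs (path_graph n) \<longleftrightarrow> (u i, u j) \<in> parcs ?H"
        using ij by (auto simp: path_graph_def)
    qed
    ultimately show False using n(2) by blast
  qed
  then show ?thesis using n(1) by (intro exI[of _ n]) simp
qed

section \<open>Transducing paths from patterns\<close>

lemma less_and_none_between:
  fixes i :: nat
  assumes "i < n" "j < n" shows "i < j \<and> \<not> (\<exists>l<n. i < l \<and> l < j) \<longleftrightarrow> j = Suc i"
proof
  assume *: "i < j \<and> \<not> (\<exists>l<n. i < l \<and> l < j)"
  have "\<not> Suc i < j" using * assms by auto
  then show "j = Suc i" using * by simp
qed auto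

abbreviation bi_edge :: "'a pair_pre_digraph \<Rightarrow> 'a \<times> bool \<Rightarrow> 'a \<times> bool \<Rightarrow> bool" where
  "bi_edge G x y \<equiv> (fst x, fst y) \<in> parcs G"

abbreviation bi_adj :: "'a pair_pre_digraph \<Rightarrow> bool \<Rightarrow> 'a \<times> bool \<Rightarrow> 'a \<times> bool \<Rightarrow> bool" where
  "bi_adj G \<equiv> sided_relation.adj snd (bi_edge G)"

abbreviation bi_verts :: "'a pair_pre_digraph \<Rightarrow> ('a \<times> bool) set" where
  "bi_verts G \<equiv> pverts G \<times> UNIV"

lemma sided_relation_bi_edge:
  assumes "pair_graph G" shows "sided_relation (bi_edge G)"
proof
  interpret pair_graph G by fact
  show "bi_edge G y x" if "bi_edge G x y" for x y using that arcs_symmetric by blast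
qed

text \<open>In a half graph with columns \<open>P 1\<close> the neighbourhoods of the rows form a
  chain, and this non-inclusion is a strict linear order on the rows. \<open>cover_query\<close> is
  its successor relation within \<open>P 0\<close>.\<close>

definition below_query :: "'a query" where
  "below_query G P a b \<longleftrightarrow> (\<exists>w\<in>pverts G. (w \<in> P 1 \<and> (a, w) \<notin> parcs G) \<and> (w, b) \<in> parcs G)"

definition cover_query :: "'a query" where
  "cover_query G P a b \<longleftrightarrow> below_query G P a b \<and>
     \<not> (\<exists>c\<in>pverts G. (c \<in> P 0 \<and> below_query G P a c) \<and> below_query G P c b)"

definition common_query :: "bool \<Rightarrow> 'a query" where
  "common_query t G P a b \<longleftrightarrow>
     (\<exists>w\<in>pverts G. (w \<in> P 1 \<and> ((a, w) \<in> parcs G) = t) \<and> ((w, b) \<in> parcs G) = t)"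

lemma definable_below: "definable below_query"
  unfolding below_query_def
  by (intro definable_compose definable_conj definable_pred2 definable_not definable_edge)

lemma definable_cover: "definable cover_query"
  unfolding cover_query_def
  by (intro definable_compose definable_conj definable_pred2 definable_not definable_below)

lemma definable_common: "definable (common_query t)"
  unfolding common_query_def
  by (intro definable_compose definable_conj definable_pred2 definable_iff_const definable_edge)

definition pattern_coloring :: "(nat \<Rightarrow> 'a) \<Rightarrow> (nat \<Rightarrow> 'a) \<Rightarrow> nat \<Rightarrow> nat \<Rightarrow> 'a set" where
  "pattern_coloring u w n = (\<lambda>k. if k = 0 then u ` {..<n} else if k = 1 then w ` {..<n} else {})"

lemma coloring_pattern_coloring:
  "u ` {..<n} \<subseteq> pverts G \<Longrightarrow> w ` {..<n} \<subseteq> pverts G \<Longrightarrow> coloring G (pattern_coloring u w n)"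
  by (auto simp: coloring_def pattern_coloring_def)

text \<open>The rows carry the path. A graph vertex may serve both as a row and as a column, through
  its two copies; the predicates then overlap, which colorings allow. Complementation reverses the
  order of the rows, and symmetrization forgets the direction.\<close>

lemma half_graph_transduces_path:
  assumes G: "pair_graph G" and half: "half_graph (bi_adj G t) n (bi_verts G) (bi_verts G)"
  shows "realizes_path cover_query G n"
proof -
  interpret G: pair_graph G by fact
  interpret sided_relation snd "bi_edge G" by (rule sided_relation_bi_edge[OF G])
  obtain a b where ab: "\<And>i. i < n \<Longrightarrow> a i \<in> bi_verts G \<and> b i \<in> bi_verts G"
    "\<And>i j. i < n \<Longrightarrow> j < n \<Longrightarrow> adj t (a i) (b j) \<longleftrightarrow> j \<le> i"
    using half unfolding half_graph_def by blast
  define u where "u i = fst (a i)" for i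
  define w where "w i = fst (b i)" for i
  define P where "P = pattern_coloring u w n"
  have V: "u i \<in> pverts G" "w i \<in> pverts G" if "i < n" for i
    using ab(1)[OF that] by (auto simp: u_def w_def mem_Times_iff)
  \<comment> \<open>\<open>adj\<close> also fails between vertices of one side, so the half graph
    must first be seen to lie across the sides: the last row and the first column are adjacent to
    everything opposite.\<close>
  have sd: "snd (a i) \<noteq> snd (b j)" if "i < n" "j < n" for i j
  proof -
    have "adj t (a (n - 1)) (b j)" "adj t (a i) (b 0)" "adj t (a (n - 1)) (b 0)"
      using ab(2) that by auto
    then show ?thesis by (auto simp: adj_def)
  qed
  have E: "((u i, w j) \<in> parcs G) = t \<longleftrightarrow> j \<le> i" if "i < n" "j < n" for i j
    using ab(2)[OF that] sd[OF that] by (simp add: adj_def u_def w_def)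
  have E': "(u i, w j) \<in> parcs G \<longleftrightarrow> (j \<le> i) = t" if "i < n" "j < n" for i j
    using E[OF that] by blast
  have inj: "inj_on u {..<n}"
  proof (rule linorder_inj_onI')
    fix i j assume "i \<in> {..<n}" "j \<in> {..<n}" "i < j"
    then show "u i \<noteq> u j" using E[of i j] E[of j j] by auto
  qed
  have P: "P 0 = u ` {..<n}" "P 1 = w ` {..<n}" by (auto simp: P_def pattern_coloring_def)
  have below: "below_query G P (u i) (u j) \<longleftrightarrow> (if t then i < j else j < i)" if "i < n" "j < n" for i j
  proof -
    have "below_query G P (u i) (u j) \<longleftrightarrow> (\<exists>l<n. (u i, w l) \<notin> parcs G \<and> (u j, w l) \<in> parcs G)"
      unfolding below_query_def P using V G.arcs_symmetric by blast
    also have "\<dots> \<longleftrightarrow> (\<exists>l<n. (l \<le> i) \<noteq> t \<and> (l \<le> j) = t)"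
      by (rule ex_cong1, rule conj_cong, rule refl)
        (simp add: E'[OF that(1)] E'[OF that(2)])
    also have "\<dots> \<longleftrightarrow> (if t then i < j else j < i)"
      using that by (cases t) (auto intro: exI[of _ j] exI[of _ i])
    finally show ?thesis .
  qed
  have between: "(\<exists>c\<in>pverts G. (c \<in> P 0 \<and> below_query G P (u i) c) \<and> below_query G P c (u j)) \<longleftrightarrow>
      (\<exists>l<n. if t then i < l \<and> l < j else l < i \<and> j < l)" if "i < n" "j < n" for i j
    unfolding P using below that V by auto
  have cover: "cover_query G P (u i) (u j) \<longleftrightarrow> (if t then j = Suc i else i = Suc j)" if "i < n" "j < n" for i j
    unfolding cover_query_def between[OF that] below[OF that]
    using less_and_none_between[of i n j] less_and_none_between[of j n i] that
    by (cases t) (simp_all add: conj_commute)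
  have "coloring G P" unfolding P_def using V by (intro coloring_pattern_coloring) auto
  then show ?thesis by (rule realizes_pathI[where P = P and u = u, OF _ inj P(1)]) (use cover in \<open>cases t; auto\<close>)
qed

text \<open>Sides alternate along the path. The vertices at even positions are kept, and two of them
  are consecutive exactly if they share a neighbour at an odd position; hence the length
  \<open>2 * n\<close>.\<close>

lemma induced_path_transduces_path:
  assumes G: "pair_graph G"
    and path: "sided_relation.induced_path snd (bi_edge G) t (2 * n) (bi_verts G)"
  shows "realizes_path (common_query t) G n"
proof -
  interpret G: pair_graph G by fact
  interpret sided_relation snd "bi_edge G" by (rule sided_relation_bi_edge[OF G])
  obtain p where p: "\<And>i. i \<le> 2 * n \<Longrightarrow> p i \<in> bi_verts G"
    "\<And>i j. i \<le> 2 * n \<Longrightarrow> j \<le> 2 * n \<Longrightarrow> adj t (p i) (p j) \<longleftrightarrow> i = Suc j \<or> j = Suc i"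
    using path unfolding induced_path_def by blast
  define u where "u i = fst (p (2 * i))" for i
  define w where "w i = fst (p (Suc (2 * i)))" for i
  define P where "P = pattern_coloring u w n"
  have V: "u i \<in> pverts G" "w i \<in> pverts G" if "i < n" for i
    using p(1)[of "2 * i"] p(1)[of "Suc (2 * i)"] that by (auto simp: u_def w_def mem_Times_iff)
  have sd: "snd (p i) = (snd (p 0) = even i)" if "i \<le> 2 * n" for i
    using that
  proof (induction i)
    case (Suc i)
    then have "adj t (p i) (p (Suc i))" using p(2) by simp
    then show ?case using Suc by (auto simp: adj_def)
  qed auto
  have E: "((u i, w j) \<in> parcs G) = t \<longleftrightarrow> j = i \<or> i = Suc j" if "i < n" "j < n" for i j
  proof -
    have le: "2 * i \<le> 2 * n" "Suc (2 * j) \<le> 2 * n" using that by auto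
    have "snd (p (2 * i)) \<noteq> snd (p (Suc (2 * j)))" using sd[OF le(1)] sd[OF le(2)] by auto
    then have "((u i, w j) \<in> parcs G) = t \<longleftrightarrow> adj t (p (2 * i)) (p (Suc (2 * j)))"
      by (simp add: adj_def u_def w_def)
    also have "\<dots> \<longleftrightarrow> j = i \<or> i = Suc j" unfolding p(2)[OF le] by auto
    finally show ?thesis .
  qed
  have E': "((w j, u i) \<in> parcs G) = t \<longleftrightarrow> j = i \<or> i = Suc j" if "i < n" "j < n" for i j
    using E[OF that] G.arcs_symmetric by blast
  have inj: "inj_on u {..<n}"
  proof (rule linorder_inj_onI')
    fix i j assume "i \<in> {..<n}" "j \<in> {..<n}" "i < j"
    then show "u i \<noteq> u j" using E[of i j] E[of j j] by auto
  qed
  have P: "P 0 = u ` {..<n}" "P 1 = w ` {..<n}" by (auto simp: P_def pattern_coloring_def)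
  have common: "common_query t G P (u i) (u j) \<longleftrightarrow> j = Suc i \<or> i = Suc j"
    if "i < n" "j < n" "i \<noteq> j" for i j
  proof -
    have "common_query t G P (u i) (u j) \<longleftrightarrow> (\<exists>l<n. ((u i, w l) \<in> parcs G) = t \<and> ((w l, u j) \<in> parcs G) = t)"
      unfolding common_query_def P using V by blast
    also have "\<dots> \<longleftrightarrow> (\<exists>l<n. (l = i \<or> i = Suc l) \<and> (l = j \<or> j = Suc l))"
      by (rule ex_cong1, rule conj_cong, rule refl) (use E[OF that(1)] E'[OF that(2)] in simp)
    also have "\<dots> \<longleftrightarrow> j = Suc i \<or> i = Suc j" using that by auto
    finally show ?thesis .
  qed
  have "coloring G P" unfolding P_def using V by (intro coloring_pattern_coloring) auto
  then show ?thesis by (rule realizes_pathI[where P = P and u = u, OF _ inj P(1)]) (use common in auto)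
qed

lemma pattern_bound:
  fixes C :: "'a pair_pre_digraph set"
  assumes C: "\<And>G. G \<in> C \<Longrightarrow> pair_graph G" and nt: "\<not> fo_transducible_from all_paths C"
  obtains n where "\<And>G t. G \<in> C \<Longrightarrow> \<not> half_graph (bi_adj G t) n (bi_verts G) (bi_verts G)"
    "\<And>G t. G \<in> C \<Longrightarrow> \<not> sided_relation.induced_path snd (bi_edge G) t n (bi_verts G)"
proof -
  obtain n1 where n1: "\<And>G. G \<in> C \<Longrightarrow> \<not> realizes_path cover_query G n1"
    using definable_path_bound[OF definable_cover nt] by blast
  have "\<exists>n. \<forall>G\<in>C. \<not> sided_relation.induced_path snd (bi_edge G) t (2 * n) (bi_verts G)" for t
    using definable_path_bound[OF definable_common nt, of t] induced_path_transduces_path C by metis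
  then obtain f where f: "\<And>t G. G \<in> C \<Longrightarrow> \<not> sided_relation.induced_path snd (bi_edge G) t (2 * f t) (bi_verts G)"
    by metis
  define n where "n = n1 + 2 * f True + 2 * f False"
  show thesis
  proof
    fix G t assume G: "G \<in> C"
    interpret sided_relation snd "bi_edge G" by (rule sided_relation_bi_edge[OF C[OF G]])
    show "\<not> half_graph (bi_adj G t) n (bi_verts G) (bi_verts G)"
    proof
      assume "half_graph (bi_adj G t) n (bi_verts G) (bi_verts G)"
      then have "half_graph (bi_adj G t) n1 (bi_verts G) (bi_verts G)"
        by (rule half_graph_le) (simp add: n_def)
      from half_graph_transduces_path[OF C[OF G] this] show False using n1[OF G] by simp
    qed
    have "2 * f t \<le> n" by (cases t) (auto simp: n_def)
    then show "\<not> induced_path t n (bi_verts G)" using f[OF G, of t] induced_path_le[of t n _ "2 * f t"] by blast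
  qed
qed

section \<open>Definable levels\<close>

fun iter_within :: "'a set \<Rightarrow> ('a \<Rightarrow> 'a \<Rightarrow> bool) \<Rightarrow> nat \<Rightarrow> 'a \<Rightarrow> 'a \<Rightarrow> bool" where
  "iter_within W R 0 x y \<longleftrightarrow> x = y"
| "iter_within W R (Suc k) x y \<longleftrightarrow> iter_within W R k x y \<or> (\<exists>z\<in>W. iter_within W R k x z \<and> R z y)"

lemma iter_within_rtranclp: "iter_within W R k x y \<Longrightarrow> R\<^sup>*\<^sup>* x y"
  by (induction k arbitrary: y) (auto intro: rtranclp.rtrancl_into_rtrancl)

lemma iter_within_le: "iter_within W R k x y \<Longrightarrow> k \<le> l \<Longrightarrow> iter_within W R l x y"
  by (induction l) (auto simp: le_Suc_eq)

lemma relpowp_iter_within: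
  assumes "(R ^^ k) x y" "\<And>u v. R u v \<Longrightarrow> u \<in> W" shows "iter_within W R k x y"
  using assms(1) by (induction k arbitrary: y) (use assms(2) in auto)

text \<open>A piece is given by \<open>q\<close>: the vertices of color \<open>q s\<close> on side \<open>s\<close>, where \<open>A s c\<close> is the set of
  graph vertices whose copy on side \<open>s\<close> has color \<open>c\<close>.\<close>

definition piece :: "(bool \<Rightarrow> nat \<Rightarrow> 'a set) \<Rightarrow> (bool \<Rightarrow> nat) \<Rightarrow> ('a \<times> bool) set" where
  "piece A q = {x. fst x \<in> A (snd x) (q (snd x))}"

text \<open>Round \<open>l\<close> connects vertices within their class of the previous round, by
  edges if \<open>l\<close> is even and by non-edges across the sides if \<open>l\<close> is odd.
  Cutting off after \<open>N\<close> steps keeps this first-order.\<close>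

fun level :: "nat \<Rightarrow> (bool \<Rightarrow> nat) \<Rightarrow> nat \<Rightarrow> 'a pair_pre_digraph \<Rightarrow> (bool \<Rightarrow> nat \<Rightarrow> 'a set) \<Rightarrow>
    'a \<times> bool \<Rightarrow> 'a \<times> bool \<Rightarrow> bool" where
  "level N q 0 G A x y \<longleftrightarrow> True"
| "level N q (Suc l) G A x y \<longleftrightarrow> iter_within (bi_verts G)
     (\<lambda>x y. level N q l G A x y \<and> x \<in> piece A q \<and> y \<in> piece A q \<and>
       snd x \<noteq> snd y \<and> bi_edge G x y = even l) N x y"

text \<open>Tags 1 and 2 separate the sides. Tag 0 is left for the predicate \<open>P 0\<close>,
  tags 3 and 4 for the marks on incidence paths.\<close>

definition color_index :: "bool \<Rightarrow> nat \<Rightarrow> nat" where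
  "color_index s c = prod_encode (if s then 1 else 2, c)"

definition bi_definable ::
    "('a pair_pre_digraph \<Rightarrow> (nat \<Rightarrow> 'a set) \<Rightarrow> 'a \<times> bool \<Rightarrow> 'a \<times> bool \<Rightarrow> bool) \<Rightarrow> bool" where
  "bi_definable Q \<longleftrightarrow> (\<forall>s t. definable (\<lambda>G P a b. Q G P (a, s) (b, t)))"

lemma bi_definable_conj:
  "bi_definable Q1 \<Longrightarrow> bi_definable Q2 \<Longrightarrow> bi_definable (\<lambda>G P x y. Q1 G P x y \<and> Q2 G P x y)"
  by (simp add: bi_definable_def definable_conj)

lemma bi_definable_iter_within:
  assumes "bi_definable Q"
  shows "bi_definable (\<lambda>G P. iter_within (bi_verts G) (Q G P) k)"
proof (induction k)
  case 0
  show ?case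
    unfolding bi_definable_def iter_within.simps prod.inject
    by (intro allI definable_conj definable_eq definable_const)
next
  case (Suc k)
  \<comment> \<open>Formulas quantify over graph vertices only, so a quantifier over copies becomes
    a disjunction over the two sides.\<close>
  have eq: "(\<exists>z\<in>bi_verts G. I z \<and> J z) \<longleftrightarrow>
      (\<exists>c\<in>pverts G. I (c, True) \<and> J (c, True)) \<or> (\<exists>c\<in>pverts G. I (c, False) \<and> J (c, False))"
    for G :: "'a pair_pre_digraph" and I J :: "'a \<times> bool \<Rightarrow> bool"
    by (auto, metis (full_types))
  show ?case
    unfolding bi_definable_def iter_within.simps eq
    using Suc assms by (intro allI definable_disj definable_compose) (simp_all add: bi_definable_def)
qed

lemma bi_definable_level: "bi_definable (\<lambda>G P. level N q l G (\<lambda>s c. P (color_index s c)))"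
proof (induction l)
  case 0
  show ?case by (simp add: bi_definable_def definable_const)
next
  case (Suc l)
  have piece: "bi_definable (\<lambda>G P x y. x \<in> piece (\<lambda>s c. P (color_index s c)) q)"
    "bi_definable (\<lambda>G P x y. y \<in> piece (\<lambda>s c. P (color_index s c)) q)"
    by (simp_all add: bi_definable_def piece_def definable_pred1 definable_pred2)
  have adj: "bi_definable (\<lambda>G P x y. snd x \<noteq> snd y \<and> bi_edge G x y = even l)"
    unfolding bi_definable_def fst_conv snd_conv
    by (intro allI definable_conj definable_const definable_iff_const definable_edge)
  show ?case unfolding level.simps[abs_def]
    by (intro bi_definable_iter_within bi_definable_conj Suc piece adj)
qed

section \<open>The bounded levels are exact connected components\<close>

locale leveled_graph =
  fixes G :: "'a pair_pre_digraph" and N m :: nat and g :: "'a \<times> bool \<Rightarrow> nat"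
  assumes graph: "pair_graph G"
    and no_path: "\<not> sided_relation.induced_path snd (bi_edge G) t N (bi_verts G)"
    and nice_pieces: "sided_relation.nice snd (bi_edge G) True m {z\<in>bi_verts G. g z = q (snd z)}"
begin

sublocale graph: pair_graph G by (rule graph)

sublocale sided_relation snd "bi_edge G" by (rule sided_relation_bi_edge[OF graph])

definition A :: "bool \<Rightarrow> nat \<Rightarrow> 'a set" where
  "A s c = {v\<in>pverts G. g (v, s) = c}"

lemma piece_A: "piece A q = {z\<in>bi_verts G. g z = q (snd z)}"
  by (auto simp: piece_def A_def)

definition L :: "(bool \<Rightarrow> nat) \<Rightarrow> nat \<Rightarrow> 'a \<times> bool \<Rightarrow> 'a \<times> bool \<Rightarrow> bool" where
  "L q l = level N q l G A"

definition level_step :: "(bool \<Rightarrow> nat) \<Rightarrow> nat \<Rightarrow> 'a \<times> bool \<Rightarrow> 'a \<times> bool \<Rightarrow> bool" where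
  "level_step q l x y \<longleftrightarrow> L q l x y \<and> x \<in> piece A q \<and> y \<in> piece A q \<and> adj (even l) x y"

lemma L_0: "L q 0 x y"
  by (simp add: L_def)

lemma L_Suc_iter: "L q (Suc l) = iter_within (bi_verts G) (level_step q l) N"
proof -
  have "level_step q l = (\<lambda>x y. level N q l G A x y \<and> x \<in> piece A q \<and> y \<in> piece A q \<and>
       snd x \<noteq> snd y \<and> bi_edge G x y = even l)"
    by (intro ext) (simp only: level_step_def L_def adj_def)
  then show ?thesis unfolding L_def by (intro ext) simp
qed

text \<open>The relevant vertices of a shortest chain lie in one level class and in the piece, so a
  chord would itself be a step and shorten the chain. If it had more than \<open>N\<close> steps,
  its first \<open>N + 1\<close> vertices would form a forbidden induced path.\<close>

lemma bounded_distance: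
  assumes eq: "equivp (L q l)" and xy: "(level_step q l)\<^sup>*\<^sup>* x y"
  shows "iter_within (bi_verts G) (level_step q l) N x y"
proof -
  let ?R = "level_step q l"
  obtain k0 where "(?R ^^ k0) x y" using xy by (auto simp: rtranclp_is_Sup_relpowp)
  define k where "k = (LEAST k. (?R ^^ k) x y)"
  have k: "(?R ^^ k) x y" unfolding k_def by (rule LeastI) fact
  have least: "k \<le> k'" if "(?R ^^ k') x y" for k' unfolding k_def using that by (rule Least_le)
  have "k \<le> N"
  proof (rule ccontr)
    assume "\<not> k \<le> N"
    obtain p where p: "p 0 = x" "p k = y" "\<And>i. i < k \<Longrightarrow> ?R (p i) (p (Suc i))"
      using k unfolding relpowp_fun_conv by blast
    have pp: "p i \<in> piece A q" if "i \<le> N" for i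
      using p(3)[of i] that \<open>\<not> k \<le> N\<close> by (simp add: level_step_def)
    have powi: "(?R ^^ (j - i)) (p i) (p j)" if "i \<le> j" "j \<le> k" for i j
      unfolding relpowp_fun_conv using p(3) that by (intro exI[of _ "\<lambda>n. p (i + n)"]) auto
    have LL: "L q l (p i) (p j)" if "i \<le> j" "j \<le> k" for i j
      using that
    proof (induction j rule: dec_induct)
      case base
      show ?case using eq by (simp add: equivp_reflp)
    next
      case (step j)
      then have "L q l (p j) (p (Suc j))" using p(3)[of j] by (simp add: level_step_def)
      then show ?case using step equivp_transp[OF eq] by (meson Suc_leD)
    qed
    have short: "j = Suc i" if "i < j" "j \<le> N" "adj (even l) (p i) (p j)" for i j
    proof (rule ccontr)
      assume "j \<noteq> Suc i"
      have "j \<le> k" using that \<open>\<not> k \<le> N\<close> by simp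
      have "?R (p i) (p j)" using LL[of i j] pp that \<open>j \<le> k\<close> by (simp add: level_step_def)
      moreover have "(?R ^^ i) x (p i)" using powi[of 0 i] that \<open>j \<le> k\<close> p(1) by simp
      moreover have "(?R ^^ (k - j)) (p j) y" using powi[of j k] \<open>j \<le> k\<close> p(2) by simp
      ultimately have "(?R ^^ (Suc i + (k - j))) x y"
        by (meson relpowp_Suc_I relpowp_trans)
      then have "k \<le> Suc i + (k - j)" by (rule least)
      then show False using that \<open>j \<le> k\<close> \<open>j \<noteq> Suc i\<close> by simp
    qed
    have ad: "adj (even l) (p i) (p (Suc i))" if "i < N" for i
      using p(3)[of i] that \<open>\<not> k \<le> N\<close> by (simp add: level_step_def)
    have "adj (even l) (p i) (p j) \<longleftrightarrow> i = Suc j \<or> j = Suc i" if ij: "i \<le> N" "j \<le> N" for i j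
    proof
      assume a: "adj (even l) (p i) (p j)"
      then have "i \<noteq> j" by (auto simp: adj_def)
      then show "i = Suc j \<or> j = Suc i"
        using short[of i j] short[of j i] a adj_sym[OF a] ij by (meson linorder_neqE_nat)
    next
      assume "i = Suc j \<or> j = Suc i"
      then show "adj (even l) (p i) (p j)" using ad[of i] adj_sym[OF ad[of j]] ij by auto
    qed
    moreover have "p i \<in> bi_verts G" if "i \<le> N" for i using pp[OF that] by (simp add: piece_A)
    ultimately have "induced_path (even l) N (bi_verts G)" unfolding induced_path_def by blast
    then show False using no_path by blast
  qed
  have W: "u \<in> bi_verts G" if "?R u v" for u v using that by (simp add: level_step_def piece_A)
  show ?thesis by (rule iter_within_le[OF relpowp_iter_within[OF k W] \<open>k \<le> N\<close>])
qed

text \<open>Both claims need each other: the cut-off at \<open>N\<close> loses nothing once the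
  current level is an equivalence, and the next level is then the closure of a symmetric relation,
  hence again an equivalence.\<close>

lemma L_equiv_Suc: "equivp (L q l) \<and> L q (Suc l) = (level_step q l)\<^sup>*\<^sup>*"
proof (induction l)
  case 0
  have "equivp (L q 0)" by (simp add: equivp_def fun_eq_iff L_0)
  moreover have "L q (Suc 0) x y \<longleftrightarrow> (level_step q 0)\<^sup>*\<^sup>* x y" for x y
    unfolding L_Suc_iter using bounded_distance[OF calculation] iter_within_rtranclp by metis
  ultimately show ?case by (intro conjI ext) simp_all
next
  case (Suc l)
  have "symp (level_step q l)"
  proof (rule sympI)
    fix x y assume "level_step q l x y"
    then show "level_step q l y x"
      using adj_sym[of "even l" x y] equivp_symp[OF conjunct1[OF Suc], of x y] by (simp add: level_step_def)
  qed
  then have "symp (level_step q l)\<^sup>*\<^sup>*" by (rule symp_rtranclp)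
  then have "equivp (level_step q l)\<^sup>*\<^sup>*"
    by (intro equivpI reflpI transpI) (auto intro: rtranclp_trans)
  then have "equivp (L q (Suc l))" using Suc by simp
  moreover have "L q (Suc (Suc l)) x y \<longleftrightarrow> (level_step q (Suc l))\<^sup>*\<^sup>* x y" for x y
    unfolding L_Suc_iter[of q "Suc l"] using bounded_distance[OF calculation] iter_within_rtranclp by metis
  ultimately show ?case by (intro conjI ext) simp_all
qed

lemmas L_equivp = L_equiv_Suc[THEN conjunct1] and L_Suc = L_equiv_Suc[THEN conjunct2]

text \<open>Each level uses up one round, because the level \<open>Suc l\<close> class of
  \<open>x\<close> is connected inside its level \<open>l\<close> class.\<close>

lemma nice_L:
  assumes "x \<in> piece A q" "l \<le> m"
  shows "nice (even l) (m - l) {y\<in>piece A q. L q l x y}"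
  using assms(2)
proof (induction l)
  case 0
  show ?case using nice_pieces[of q] by (simp add: piece_A L_0)
next
  case (Suc l)
  let ?X = "{y\<in>piece A q. L q l x y}"
  have x: "x \<in> ?X" using assms(1) equivp_reflp[OF L_equivp] by simp
  have "{y\<in>piece A q. L q (Suc l) x y} \<subseteq> comp (even l) ?X x"
  proof
    fix y assume "y \<in> {y\<in>piece A q. L q (Suc l) x y}"
    then have "(level_step q l)\<^sup>*\<^sup>* x y" by (simp add: L_Suc)
    then show "y \<in> comp (even l) ?X x"
    proof induction
      case base
      show ?case by (rule component_refl[OF x])
    next
      case (step u w)
      have "u \<in> ?X" using component_subset step.IH by (rule subsetD)
      then have "w \<in> ?X"
        using step(2) equivp_transp[OF L_equivp, of q l x u w] by (simp add: level_step_def)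
      moreover have "adj (even l) u w" using step(2) by (simp add: level_step_def)
      ultimately show ?case using component_step[OF step.IH] by blast
    qed
  qed
  moreover have "m - l = Suc (m - Suc l)" using Suc.prems by simp
  then have "nice (even l) (Suc (m - Suc l)) ?X" using Suc by simp
  then have "nice (\<not> even l) (m - Suc l) (comp (even l) ?X x)"
    unfolding nice.simps by (rule bspec) (rule x)
  ultimately show ?case using nice_subset[of "odd l"] by simp
qed

lemma L_m_same_side:
  assumes "x \<in> piece A q" "y \<in> piece A q" "L q m x y" shows "snd x = snd y"
proof -
  have "\<forall>x'\<in>{y\<in>piece A q. L q m x y}. \<forall>y'\<in>{y\<in>piece A q. L q m x y}. snd x' = snd y'"
    using nice_L[OF assms(1) order_refl] by (simp only: diff_self_eq_0 nice.simps)
  moreover have "L q m x x" by (rule equivp_reflp[OF L_equivp])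
  ultimately show ?thesis using assms by blast
qed

text \<open>Two copies in one level \<open>l\<close> class but not joined by a step there must have
  the adjacency opposite to the one that round \<open>l\<close> connects.\<close>

lemma edge_level:
  assumes "(u, True) \<in> piece A q" "(w, False) \<in> piece A q" "L q l (u, True) (w, False)"
    "\<not> L q (Suc l) (u, True) (w, False)"
  shows "(u, w) \<in> parcs G \<longleftrightarrow> odd l"
proof -
  have "\<not> level_step q l (u, True) (w, False)" using assms(4) by (auto simp: L_Suc)
  then show ?thesis using assms(1-3) by (simp add: level_step_def adj_def)
qed

text \<open>After \<open>m\<close> rounds no class within the piece meets both sides, so the two
  copies separate at some level, whose parity reveals the adjacency.\<close>

lemma edge_determined:
  assumes "u \<in> pverts G" "w \<in> pverts G" "u' \<in> pverts G" "w' \<in> pverts G"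
    "g (u, True) = g (u', True)" "g (w, False) = g (w', False)"
    "q = (\<lambda>s. if s then g (u, True) else g (w, False))"
    "\<And>l. l \<le> m \<Longrightarrow> L q l (u, True) (w, False) \<longleftrightarrow> L q l (u', True) (w', False)"
  shows "(u, w) \<in> parcs G \<longleftrightarrow> (u', w') \<in> parcs G"
proof -
  have pc: "(u, True) \<in> piece A q" "(w, False) \<in> piece A q" "(u', True) \<in> piece A q" "(w', False) \<in> piece A q"
    using assms(1-7) by (auto simp: piece_A)
  have "\<not> L q m (u, True) (w, False)" using L_m_same_side[OF pc(1,2)] by auto
  then obtain l where l: "l < m" "L q l (u, True) (w, False)" "\<not> L q (Suc l) (u, True) (w, False)"
    using switch_point[of "\<lambda>l. L q l (u, True) (w, False)" m] L_0 by blast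
  then have "L q l (u', True) (w', False)" "\<not> L q (Suc l) (u', True) (w', False)"
    using assms(8) by auto
  then show ?thesis using edge_level pc l by metis
qed

end

section \<open>Incidence paths and the main theorem\<close>

text \<open>A slot \<open>((i, j), l, s)\<close> of a vertex is the level \<open>l\<close> class of its copy on side \<open>s\<close>, within the
  piece of color \<open>i\<close> on the left and color \<open>j\<close> on the right.\<close>

type_synonym slot = "(nat \<times> nat) \<times> nat \<times> bool"

definition piece_colors :: "nat \<times> nat \<Rightarrow> bool \<Rightarrow> nat" where
  "piece_colors ij s = (if s then fst ij else snd ij)"

definition slots :: "nat \<Rightarrow> slot set" where
  "slots m = ({..<m} \<times> {..<m}) \<times> {..m} \<times> UNIV"

lemma finite_slots: "finite (slots m)"
  by (simp add: slots_def)

definition out_index :: "slot \<Rightarrow> nat" where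
  "out_index s = prod_encode (3, to_nat s)"

definition in_index :: "slot \<Rightarrow> nat" where
  "in_index s = prod_encode (4, to_nat s)"

definition incidence_query :: "nat \<Rightarrow> nat \<Rightarrow> 'a query" where
  "incidence_query N m G P a b \<longleftrightarrow> (\<exists>s\<in>slots m. \<exists>t\<in>slots m.
     (a \<in> P (out_index s) \<and> b \<in> P (in_index t)) \<and> (fst s = fst t \<and> fst (snd s) = fst (snd t)) \<and>
     level N (piece_colors (fst s)) (fst (snd s)) G (\<lambda>s c. P (color_index s c))
       (a, snd (snd s)) (b, snd (snd t)))"

lemma definable_incidence: "definable (incidence_query N m)"
proof -
  have lev: "definable (\<lambda>G P a b. level N q l G (\<lambda>s c. P (color_index s c)) (a, s) (b, t))" for q l s t
    using bi_definable_level unfolding bi_definable_def by blast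
  show ?thesis
    unfolding incidence_query_def[abs_def]
    by (intro definable_Bex finite_slots definable_conj definable_pred1 definable_pred2 definable_const lev)
qed

context leveled_graph
begin

text \<open>Piece and level are stored in the class, so that classes of different pieces or levels
  stay distinct even when they agree as sets.\<close>

definition cl :: "'a \<Rightarrow> slot \<Rightarrow> (nat \<times> nat) \<times> nat \<times> ('a \<times> bool) set" where
  "cl v s = (fst s, fst (snd s), {y. L (piece_colors (fst s)) (fst (snd s)) (v, snd (snd s)) y})"

lemma cl_eq_iff: "cl v s = cl w t \<longleftrightarrow> fst s = fst t \<and> fst (snd s) = fst (snd t) \<and>
    L (piece_colors (fst s)) (fst (snd s)) (v, snd (snd s)) (w, snd (snd t))"
proof -
  have "L q l x y \<longleftrightarrow> L q l x = L q l y" for q l x y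
    using L_equivp[of q l] unfolding equivp_def by blast
  moreover have "{y. L q l x y} = {z. L q l y z} \<longleftrightarrow> L q l x = L q l y" for q l x y
    by (auto simp: fun_eq_iff)
  ultimately show ?thesis unfolding cl_def prod.inject by metis
qed

text \<open>The class entered at \<open>p j\<close> is the one left at \<open>p (j - 1)\<close>. As
  the classes on the path are distinct, it is the class left at \<open>p i\<close> only for
  \<open>i = j - 1\<close>, however many other incidences exist.\<close>

lemma class_path_realizes_path:
  assumes "class_path cl (slots m) {} (pverts G) n v"
  shows "realizes_path (incidence_query N m) G n"
proof -
  obtain p a b where p: "inj_on p {..n}" "\<forall>i\<le>n. p i \<in> pverts G"
    "\<forall>i<n. a i \<in> slots m \<and> b i \<in> slots m \<and> cl (p i) (a i) = cl (p (Suc i)) (b i)"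
    "inj_on (\<lambda>i. cl (p i) (a i)) {..<n}"
    using assms unfolding class_path_def empty_iff not_False_eq_True simp_thms
    by (elim exE conjE) (rule that)
  \<comment> \<open>Tag 3 marks exits and tag 4 entries; \<open>b i\<close> is recorded at
    \<open>p (Suc i)\<close>, the vertex being entered. Only the first \<open>n\<close> of the
    \<open>n + 1\<close> vertices are used.\<close>
  define P where "P k = (case prod_decode k of (t, c) \<Rightarrow>
    if t = 0 \<and> c = 0 then p ` {..<n} else if t = 1 then A True c else if t = 2 then A False c
    else if t = 3 then {p i | i. i < n \<and> to_nat (a i) = c}
    else if t = 4 then {p (Suc i) | i. Suc i < n \<and> to_nat (b i) = c} else {})" for k
  have "prod_encode (0, 0) = 0" by (simp add: prod_encode_def)
  then have "prod_decode 0 = (0, 0)" by (metis prod_encode_inverse)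
  then have P0: "P 0 = p ` {..<n}" by (simp add: P_def)
  have PA: "(\<lambda>s c. P (color_index s c)) = A"
    by (intro ext) (simp add: P_def color_index_def)
  have Pout: "P (out_index s) = {p i | i. i < n \<and> a i = s}" for s
    by (simp add: P_def out_index_def)
  have Pin: "P (in_index s) = {p (Suc i) | i. Suc i < n \<and> b i = s}" for s
    by (simp add: P_def in_index_def)
  have "coloring G P"
    unfolding coloring_def
  proof
    fix k
    show "P k \<subseteq> pverts G" using p(2) by (auto simp: P_def A_def split: prod.splits if_splits)
  qed
  moreover have inj: "inj_on p {..<n}" using p(1) by (rule inj_on_subset) auto
  moreover have "incidence_query N m G P (p i) (p j) \<longleftrightarrow> j = Suc i" if ij: "i < n" "j < n" for i j
  proof
    assume "incidence_query N m G P (p i) (p j)"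
    then obtain s t where st: "p i \<in> P (out_index s)" "p j \<in> P (in_index t)" "fst s = fst t"
      "fst (snd s) = fst (snd t)"
      "L (piece_colors (fst s)) (fst (snd s)) (p i, snd (snd s)) (p j, snd (snd t))"
      unfolding incidence_query_def PA L_def by blast
    have cl_st: "cl (p i) s = cl (p j) t" using st by (simp add: cl_eq_iff)
    obtain i' where "i' < n" "a i' = s" "p i' = p i" using st(1) Pout by auto
    then have s: "s = a i" using inj ij by (auto dest: inj_onD)
    obtain j' where j': "Suc j' < n" "b j' = t" "p (Suc j') = p j" using st(2) Pin by auto
    then have "j = Suc j'" using inj ij by (auto dest: inj_onD)
    have "cl (p j') (a j') = cl (p (Suc j')) (b j')" using p(3) j'(1) Suc_lessD by blast
    also have "\<dots> = cl (p i) (a i)" unfolding j' cl_st[symmetric] s ..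
    finally have "cl (p i) (a i) = cl (p j') (a j')" by (rule sym)
    then have "i = j'" using p(4) ij j' by (auto dest: inj_onD)
    then show "j = Suc i" using \<open>j = Suc j'\<close> by simp
  next
    assume j: "j = Suc i"
    then have "cl (p i) (a i) = cl (p j) (b i)" using p(3) ij by simp
    moreover have "p i \<in> P (out_index (a i))" "p j \<in> P (in_index (b i))" using Pout Pin ij j by auto
    moreover have "a i \<in> slots m" "b i \<in> slots m" using p(3) ij by auto
    ultimately show "incidence_query N m G P (p i) (p j)"
      unfolding incidence_query_def PA cl_eq_iff L_def by blast
  qed
  ultimately show ?thesis by (intro realizes_pathI[where P = P and u = p, OF _ _ P0]) auto
qed

text \<open>Level 0 puts all copies into one class, so the elimination starts from a connected set
  and has a single root.\<close>

lemma component_cl: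
  assumes "v \<in> pverts G" "1 \<le> m"
  shows "component (linked cl (slots m) {}) (pverts G) v = pverts G"
proof
  show "pverts G \<subseteq> component (linked cl (slots m) {}) (pverts G) v"
  proof
    fix x assume x: "x \<in> pverts G"
    have "((0, 0), 0, True) \<in> slots m" using assms(2) by (simp add: slots_def)
    moreover have "cl v ((0, 0), 0, True) = cl x ((0, 0), 0, True)" by (simp add: cl_eq_iff L_0)
    ultimately have "linked cl (slots m) {} v x" unfolding linked_def by blast
    then show "x \<in> component (linked cl (slots m) {}) (pverts G) v"
      using component_step[of v _ "pverts G" v x] component_refl[OF assms(1)] x by blast
  qed
qed (rule component_subset)

text \<open>Besides its piece colors, a leaf remembers which of its classes are shared with the
  vertices naming its ancestors. Ancestors are addressed by depth, so the number of possible colors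
  is bounded.\<close>

definition color_data :: "(nat \<Rightarrow> 'a \<Rightarrow> 'a) \<Rightarrow> nat \<Rightarrow> 'a \<Rightarrow> nat \<times> nat \<times> (nat \<times> slot \<times> slot) set" where
  "color_data R n u = (g (u, True), g (u, False),
     {(e, r, s). e \<le> n \<and> r \<in> slots m \<and> s \<in> slots m \<and> cl (R e u) r = cl u s})"

text \<open>A class shared by \<open>u\<close> and \<open>w\<close> also belongs to the vertex
  naming a common ancestor, so both colors record it under the same \<open>e\<close> and
  \<open>r\<close>. Equal colors transfer this to \<open>u'\<close> and \<open>w'\<close>, which
  also have a common ancestor at depth \<open>e\<close>.\<close>

lemma color_data_determines_classes:
  assumes lay: "layering cl (slots m) {} (pverts G) n R"
    and V: "u \<in> pverts G" "w \<in> pverts G" "u' \<in> pverts G" "w' \<in> pverts G"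
    and d: "d < n" "R d u = R d w" "R (Suc d) u \<noteq> R (Suc d) w" "R d u' = R d w'"
    and col: "color_data R n u = color_data R n u'" "color_data R n w = color_data R n w'"
    and st: "s \<in> slots m" "t \<in> slots m" "cl u s = cl w t"
  shows "cl u' s = cl w' t"
proof -
  obtain e r where e: "e \<le> d" "r \<in> slots m" "cl (R e u) r = cl u s"
    using layering_separate[OF lay V(1,2) st(1,2) d(2,3) st(3)] by blast
  have "R e u = R e w" "R e u' = R e w'" 
    using layering_refine_le[OF lay e(1) V(1,2) d(2)] layering_refine_le[OF lay e(1) V(3,4) d(4)] by simp_all
  then have "cl (R e w) r = cl w t" using e st(3) by simp
  then have "(e, r, t) \<in> snd (snd (color_data R n w))" using e st d(1) by (simp add: color_data_def)
  then have "cl (R e w') r = cl w' t" unfolding col(2) by (simp add: color_data_def)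
  moreover have "(e, r, s) \<in> snd (snd (color_data R n u))" using e st d(1) by (simp add: color_data_def)
  then have "cl (R e u') r = cl u' s" unfolding col(1) by (simp add: color_data_def)
  ultimately show ?thesis using \<open>R e u' = R e w'\<close> by simp
qed

lemma color_data_determines_edges:
  assumes lay: "layering cl (slots m) {} (pverts G) n R"
    and V: "u \<in> pverts G" "w \<in> pverts G" "u' \<in> pverts G" "w' \<in> pverts G"
    and d: "R d u = R d w" "R (Suc d) u \<noteq> R (Suc d) w" "R d u' = R d w'" "R (Suc d) u' \<noteq> R (Suc d) w'"
    and col: "color_data R n u = color_data R n u'" "color_data R n w = color_data R n w'"
    and g: "\<And>z. z \<in> bi_verts G \<Longrightarrow> g z < m"
  shows "(u, w) \<in> parcs G \<longleftrightarrow> (u', w') \<in> parcs G"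
proof -
  \<comment> \<open>Labels on layer \<open>n\<close> are injective, so branching occurs strictly
    above it.\<close>
  have dn: "d < n"
  proof (rule ccontr)
    assume "\<not> d < n"
    then have "R n u = R n w" using layering_refine_le[OF lay _ V(1,2), of n d] d(1) by simp
    then show False using layering_inj[OF lay V(1,2)] d(2) by simp
  qed
  let ?ij = "(g (u, True), g (w, False))"
  have gg: "g (u, True) = g (u', True)" "g (w, False) = g (w', False)"
    using col by (simp_all add: color_data_def)
  have "L (piece_colors ?ij) l (u, True) (w, False) \<longleftrightarrow> L (piece_colors ?ij) l (u', True) (w', False)"
    if l: "l \<le> m" for l
  proof -
    have sl: "(?ij, l, True) \<in> slots m" "(?ij, l, False) \<in> slots m"
      using g V l by (simp_all add: slots_def)
    have "cl u (?ij, l, True) = cl w (?ij, l, False) \<longleftrightarrow> cl u' (?ij, l, True) = cl w' (?ij, l, False)"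
      using color_data_determines_classes[OF lay V dn d(1,2,3) col sl]
        color_data_determines_classes[OF lay V(3,4,1,2) dn d(3,4,1) col(1)[symmetric] col(2)[symmetric] sl]
      by blast
    then show ?thesis by (simp add: cl_eq_iff)
  qed
  moreover have "piece_colors ?ij = (\<lambda>s. if s then g (u, True) else g (w, False))"
    by (simp add: piece_colors_def fun_eq_iff)
  ultimately show ?thesis using edge_determined[OF V gg] by blast
qed

end

definition color_space :: "nat \<Rightarrow> nat \<Rightarrow> (nat \<times> nat \<times> (nat \<times> slot \<times> slot) set) set" where
  "color_space n m = {..<m} \<times> {..<m} \<times> Pow ({..n} \<times> slots m \<times> slots m)"

lemma finite_color_space: "finite (color_space n m)"
  by (simp add: color_space_def finite_slots)

lemma (in leveled_graph) tree_model_if_no_class_path: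
  assumes "pverts G \<noteq> {}" "1 \<le> m" "\<And>z. z \<in> bi_verts G \<Longrightarrow> g z < m"
    and "\<not> realizes_path (incidence_query N m) G n"
  shows "\<exists>(T :: nat pair_pre_digraph) r c f.
    tree_model (card (color_space n m)) n T r c f \<and> graph_iso G (model_graph T c f)"
proof -
  obtain v where v: "v \<in> pverts G" using assms(1) by blast
  have "\<not> class_path cl (slots m) {} (pverts G) n v" using class_path_realizes_path assms(4) by blast
  then obtain R where lay: "layering cl (slots m) {} (pverts G) n R"
    using layering_exists[OF v component_cl[OF v assms(2)]] by blast
  obtain enc where enc: "bij_betw enc (color_space n m) {1..card (color_space n m)}"
    using finite_same_card_bij[OF finite_color_space, of "{1..card (color_space n m)}"] by auto
  have cs: "color_data R n u \<in> color_space n m" if "u \<in> pverts G" for u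
    using assms(3) that by (auto simp: color_data_def color_space_def)
  have enc_eq: "enc x = enc y \<Longrightarrow> x \<in> color_space n m \<Longrightarrow> y \<in> color_space n m \<Longrightarrow> x = y" for x y
    using enc by (auto simp: bij_betw_def dest: inj_onD)
  show ?thesis
  proof (rule tree_model_if_layers[OF graph refl assms(1), where R = R and col = "\<lambda>u. enc (color_data R n u)"])
    show "R 0 u = R 0 w" if "u \<in> pverts G" "w \<in> pverts G" for u w
      using layering_root[OF lay that] .
    show "R d u = R d w" if "u \<in> pverts G" "w \<in> pverts G" "R (Suc d) u = R (Suc d) w" for d u w
      using layering_refine[OF lay that] .
    show "u = w" if "u \<in> pverts G" "w \<in> pverts G" "R n u = R n w" for u w
      using layering_inj[OF lay that] .
    show "enc (color_data R n u) \<in> {1..card (color_space n m)}" if "u \<in> pverts G" for u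
      using cs[OF that] enc bij_betwE by blast
    show "(u', w') \<in> parcs G" if *: "u \<in> pverts G" "w \<in> pverts G" "u' \<in> pverts G" "w' \<in> pverts G"
      "R d u = R d w" "R (Suc d) u \<noteq> R (Suc d) w" "R d u' = R d w'" "R (Suc d) u' \<noteq> R (Suc d) w'"
      "enc (color_data R n u) = enc (color_data R n u')" "enc (color_data R n w) = enc (color_data R n w')"
      "(u, w) \<in> parcs G" for d u w u' w'
    proof -
      have "color_data R n u = color_data R n u'" "color_data R n w = color_data R n w'"
        using enc_eq[OF *(9) cs cs] enc_eq[OF *(10) cs cs] * by blast+
      then show ?thesis using color_data_determines_edges[OF lay *(1-8) _ _ assms(3)] *(11) by blast
    qed
  qed
qed

theorem theorem1p7:
  fixes C :: "'a pair_pre_digraph set"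
  assumes "\<And>G. G \<in> C \<Longrightarrow> pair_graph G"
    and "\<not> fo_transducible_from all_paths C"
  shows "bounded_shrubdepth C"
proof -
  obtain N where N: "\<And>G t. G \<in> C \<Longrightarrow> \<not> half_graph (bi_adj G t) N (bi_verts G) (bi_verts G)"
    "\<And>G t. G \<in> C \<Longrightarrow> \<not> sided_relation.induced_path snd (bi_edge G) t N (bi_verts G)"
    using pattern_bound[of C] assms by blast
  define m where "m = structure_bound N"
  obtain n where n: "\<And>G. G \<in> C \<Longrightarrow> \<not> realizes_path (incidence_query N m) G n"
    using definable_path_bound[OF definable_incidence assms(2)] by blast
  have "\<exists>(T :: nat pair_pre_digraph) r c f.
      tree_model (card (color_space n m)) n T r c f \<and> graph_iso G (model_graph T c f)"
    if G: "G \<in> C" "pverts G \<noteq> {}" for G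
  proof -
    interpret S: sided_relation snd "bi_edge G"
      by (rule sided_relation_bi_edge[OF assms(1)[OF G(1)]])
    have "S.small True m (bi_verts G)"
      unfolding m_def by (rule S.small_if_no_patterns) (use N[OF G(1)] in blast)+
    then obtain g where g: "\<forall>z\<in>bi_verts G. g z < m" "\<forall>q. S.nice True m {z\<in>bi_verts G. g z = q (snd z)}"
      unfolding S.small_def by blast
    interpret leveled_graph G N m g
      by (rule leveled_graph.intro[OF assms(1)[OF G(1)] N(2)[OF G(1)]]) (use g(2) in blast)
    show ?thesis
      by (rule tree_model_if_no_class_path[OF G(2) _ _ n[OF G(1)]])
        (use g(1) structure_bound_ge in \<open>auto simp: m_def\<close>)
  qed
  then show ?thesis unfolding bounded_shrubdepth_def by blast
qed

end
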